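(* There exists $n_0$ such that for every $n \geq n_0$ the following holds. If $\mathcal{A}, \mathcal{B} \subset S_n$ is a cross-intersecting pair of families which are not both contained within the same 1-coset, then \[|\mathcal{A}||\mathcal{B}| \leq \big((n-1)! - d_{n-1} - d_{n-2}\big)\big((n-1)! + 1\big),\] with equality if and only if \[\mathcal{A} = \{\sigma \in S_n : \sigma(i) = j,\ \sigma \text{ intersects } \rho\}, \qquad \mathcal{B} = \{\sigma \in S_n : \sigma(i) = j\} \cup \{\rho\}\] for some $i, j \in [n]$ and some $\rho \in S_n$ with $\rho(i) \neq j$.
   Context: $S_n$ is the symmetric group on $[n]=\{1,\ldots,n\}$. Two permutations $\sigma,\rho$ intersect if $\sigma(k)=\rho(k)$ for some $k\in[n]$. A pair of families $\mathcal{A},\mathcal{B} \subset S_n$ is cross-intersecting if every $\sigma \in \mathcal{A}$ intersects every $\tau \in \mathcal{B}$. A 1-coset of $S_n$ is a set of the form $\{\sigma \in S_n : \sigma(i)=j\}$ for some $i,j\in[n]$. $d_m$ denotes the number of derangements (fixed-point-free permutations) of an $m$-element set.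
   Formalization: The equality case is stated up to exchanging A and B: equality holds if and only if (A, B) or (B, A) has the displayed form, since the bound is symmetric and the exchanged pair also attains it. *)

theory Defs
  imports "HOL-Combinatorics.Permutations"
begin

definition Sym :: "nat \<Rightarrow> (nat \<Rightarrow> nat) set" where
  "Sym n = {\<sigma>. \<sigma> permutes {1..n}}"

definition perm_intersect :: "nat \<Rightarrow> (nat \<Rightarrow> nat) \<Rightarrow> (nat \<Rightarrow> nat) \<Rightarrow> bool" where
  "perm_intersect n \<sigma> \<rho> \<longleftrightarrow> (\<exists>k\<in>{1..n}. \<sigma> k = \<rho> k)"

definition cross_intersecting :: "nat \<Rightarrow> (nat \<Rightarrow> nat) set \<Rightarrow> (nat \<Rightarrow> nat) set \<Rightarrow> bool" where
  "cross_intersecting n A B \<longleftrightarrow> (\<forall>\<sigma>\<in>A. \<forall>\<tau>\<in>B. perm_intersect n \<sigma> \<tau>)"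

definition coset1 :: "nat \<Rightarrow> nat \<Rightarrow> nat \<Rightarrow> (nat \<Rightarrow> nat) set" where
  "coset1 n i j = {\<sigma> \<in> Sym n. \<sigma> i = j}"

definition derangements :: "nat \<Rightarrow> nat" where
  "derangements m = card {\<sigma>. \<sigma> permutes {1..m} \<and> (\<forall>k\<in>{1..m}. \<sigma> k \<noteq> k)}"

end

theory Submission
  imports Defs "HOL-Analysis.Convex" "HOL-Library.Indicator_Function" "HOL-Real_Asymp.Real_Asymp"
begin

text \<open>
  Write \<open>N\<close> for the number of agreements of \<open>\<sigma> \<in> A\<close> and \<open>\<tau> \<in> B\<close>, and \<open>T(i,j)\<close> for the 1-cosets.
  Since \<open>N \<ge> 1\<close>, the sum of \<open>(N - 1)(M - N)\<close> over \<open>A \<times> B\<close> is nonnegative up to the contribution of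
  \<open>N > M\<close>, which is negligible as soon as \<open>M!\<close> beats a power of \<open>n\<close>. The sum of \<open>N\<close> is the sum of
  \<open>|A \<inter> T(i,j)| |B \<inter> T(i,j)|\<close>, and the sum of \<open>N\<^sup>2\<close> is bounded below by applying to every slice
  \<open>T(i,j)\<close> the spectral gap of the positive semidefinite kernel \<open>N - 1\<close>. If \<open>|A||B|\<close> is near the
  bound, it follows that the cell counts of \<open>A\<close> and \<open>B\<close> are correlated, and a fourth moment
  inequality then produces a coset containing at least \<open>(n-1)!\<close> divided by a power of \<open>M\<close> elements of
  \<open>A\<close>. The weak bound \<open>|A||B| \<le> (M+2)\<^sup>2 (n-1)!\<^sup>2\<close>, which comes from the same inequality, shows inside
  this coset that almost no element of \<open>B\<close> lies outside of it. So both families essentially live in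
  one coset. An element \<open>\<rho>\<close> of \<open>B\<close> outside of it forces \<open>A\<close> to lose the \<open>d(n-1) + d(n-2)\<close> elements of the
  coset that miss \<open>\<rho>\<close>, and further elements outside cost \<open>A\<close> more than \<open>B\<close> gains.
\<close>

section \<open>Counting permutations with prescribed values\<close>

text \<open>The proof lives on a margin of constants. Write F = (n-1)!, a = |A|, b = |B|. The
  claimed bound is about (1 - 1/e) F^2, while the lower bound on the sum of N^2 loses about F
  sqrt(ab) / 2. That is affordable because ab is well above F^2 / 4. Plain Cauchy-Schwarz in every
  slice would lose F sqrt(ab), which exceeds ab itself whenever ab < F^2, and nothing would remain.
  The factor 2 is saved because indicator functions are nonnegative: see
  \<open>cell_form_indicator_bounds\<close>. The estimates m!/3 \<le> d(m) \<le> m!/2 then already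
  put ab at 0.49 F^2. The second tension is in the choice of M. The tail needs M! to exceed 100 n^4,
  while all later losses are powers of M, of total degree 14, and have to stay below n; M of order
  n^(1/20) does both. Losing powers of M is harmless because each further prescribed value of a
  permutation divides the number of candidates by about n.\<close>

lemma finite_Sym [simp]: "finite (Sym n)"
  unfolding Sym_def by (simp add: finite_permutations)

lemma card_Sym: "card (Sym n) = fact n"
  unfolding Sym_def by (simp add: card_permutations)

text \<open>Left composition with \<open>\<rho>\<close> turns prescribed values into fixed points:
  the permutations in question form a coset of the pointwise stabiliser of \<open>X\<close>. Counts
  with prescribed values reduce in this way to permutations of a smaller set.\<close>

lemma bij_betw_permutes_agree:
  assumes "\<rho> permutes S" "X \<subseteq> S"
  shows "bij_betw ((\<circ>) \<rho>) {\<pi>. \<pi> permutes (S - X)}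
           {\<sigma>. \<sigma> permutes S \<and> (\<forall>x\<in>X. \<sigma> x = \<rho> x)}"
proof (rule bij_betw_byWitness[where f' = "(\<circ>) (inv \<rho>)"])
  show "\<forall>\<pi>\<in>{\<pi>. \<pi> permutes (S - X)}. inv \<rho> \<circ> (\<rho> \<circ> \<pi>) = \<pi>"
    using permutes_inv_o[OF assms(1)] by (auto simp: o_assoc)
  show "\<forall>\<sigma>\<in>{\<sigma>. \<sigma> permutes S \<and> (\<forall>x\<in>X. \<sigma> x = \<rho> x)}. \<rho> \<circ> (inv \<rho> \<circ> \<sigma>) = \<sigma>"
    using permutes_inv_o[OF assms(1)] by (auto simp: o_assoc)
  show "(\<circ>) \<rho> ` {\<pi>. \<pi> permutes (S - X)} \<subseteq> {\<sigma>. \<sigma> permutes S \<and> (\<forall>x\<in>X. \<sigma> x = \<rho> x)}"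
  proof safe
    fix \<pi> assume p: "\<pi> permutes (S - X)"
    then have "\<pi> permutes S" by (rule permutes_subset) auto
    then show "\<rho> \<circ> \<pi> permutes S" using assms(1) by (rule permutes_compose)
    show "(\<rho> \<circ> \<pi>) x = \<rho> x" if "x \<in> X" for x
      using permutes_not_in[OF p, of x] that by simp
  qed
  show "(\<circ>) (inv \<rho>) ` {\<sigma>. \<sigma> permutes S \<and> (\<forall>x\<in>X. \<sigma> x = \<rho> x)} \<subseteq> {\<pi>. \<pi> permutes (S - X)}"
  proof safe
    fix \<sigma> assume s: "\<sigma> permutes S" "\<forall>x\<in>X. \<sigma> x = \<rho> x"
    have "inv \<rho> \<circ> \<sigma> permutes S"
      using s(1) permutes_inv[OF assms(1)] by (rule permutes_compose)
    then show "inv \<rho> \<circ> \<sigma> permutes (S - X)"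
      by (rule permutes_superset) (use s assms permutes_inverses[OF assms(1)] in auto)
  qed
qed

lemma card_permutes_agree:
  assumes "finite S" "\<rho> permutes S" "X \<subseteq> S"
  shows "card {\<sigma>. \<sigma> permutes S \<and> (\<forall>x\<in>X. \<sigma> x = \<rho> x)} = fact (card S - card X)"
proof -
  have "card {\<sigma>. \<sigma> permutes S \<and> (\<forall>x\<in>X. \<sigma> x = \<rho> x)} = card {\<pi>. \<pi> permutes (S - X)}"
    using bij_betw_same_card[OF bij_betw_permutes_agree[OF assms(2,3)]] by simp
  also have "\<dots> = fact (card S - card X)"
    using assms by (subst card_permutations[OF refl]) (auto simp: card_Diff_subset finite_subset)
  finally show ?thesis .
qed

lemma card_permutes_agree_and:
  assumes "\<rho> permutes S" "X \<subseteq> S"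
  shows "card {\<sigma>. \<sigma> permutes S \<and> (\<forall>x\<in>X. \<sigma> x = \<rho> x) \<and> P \<sigma>}
    = card {\<pi>. \<pi> permutes (S - X) \<and> P (\<rho> \<circ> \<pi>)}"
proof -
  have b: "bij_betw ((\<circ>) \<rho>) {\<pi>. \<pi> permutes (S - X)}
           {\<sigma>. \<sigma> permutes S \<and> (\<forall>x\<in>X. \<sigma> x = \<rho> x)}"
    using assms by (rule bij_betw_permutes_agree)
  have "bij_betw ((\<circ>) \<rho>) {\<pi>. \<pi> permutes (S - X) \<and> P (\<rho> \<circ> \<pi>)}
           {\<sigma>. \<sigma> permutes S \<and> (\<forall>x\<in>X. \<sigma> x = \<rho> x) \<and> P \<sigma>}"
  proof (rule bij_betw_subset[OF b])
    have "(\<circ>) \<rho> ` {\<pi>. \<pi> permutes (S - X)} = {\<sigma>. \<sigma> permutes S \<and> (\<forall>x\<in>X. \<sigma> x = \<rho> x)}"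
      using b by (simp add: bij_betw_def)
    then show "(\<circ>) \<rho> ` {\<pi>. \<pi> permutes (S - X) \<and> P (\<rho> \<circ> \<pi>)}
        = {\<sigma>. \<sigma> permutes S \<and> (\<forall>x\<in>X. \<sigma> x = \<rho> x) \<and> P \<sigma>}"
      by (auto simp: set_eq_iff image_iff) metis
  qed auto
  then show ?thesis by (simp add: bij_betw_same_card)
qed

text \<open>Two transpositions of values repair \<open>\<rho>\<close> at \<open>i\<close> and
  \<open>k\<close>. The second one exchanges \<open>l\<close> with \<open>\<pi>1 k\<close>, neither
  of which is \<open>j\<close>, so the value at \<open>i\<close> survives. Keeping
  \<open>\<rho>\<close> wherever the repair does not reach is what later lets disagreement with
  \<open>\<rho>\<close> be read as absence of fixed points.\<close>

lemma permutes_with_two_values: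
  assumes "i \<in> S" "j \<in> S" "k \<in> S" "l \<in> S" "i \<noteq> k" "j \<noteq> l" "\<rho> permutes S"
  obtains \<pi> where "\<pi> permutes S" "\<pi> i = j" "\<pi> k = l"
    "\<And>x. x \<noteq> i \<Longrightarrow> x \<noteq> k \<Longrightarrow> \<rho> x \<noteq> j \<Longrightarrow> \<rho> x \<noteq> l \<Longrightarrow> \<pi> x = \<rho> x"
proof -
  define \<pi>1 where "\<pi>1 = transpose j (\<rho> i) \<circ> \<rho>"
  define \<pi> where "\<pi> = transpose l (\<pi>1 k) \<circ> \<pi>1"
  have inj: "inj \<rho>" using assms(7) by (rule permutes_inj)
  have p1: "\<pi>1 permutes S" unfolding \<pi>1_def
    by (intro permutes_compose[OF assms(7)] permutes_swap_id) (use assms permutes_in_image[OF assms(7)] in auto)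
  have inj1: "inj \<pi>1" using p1 by (rule permutes_inj)
  have 1: "\<pi>1 i = j" by (simp add: \<pi>1_def)
  have "\<pi>1 k \<noteq> j" using 1 inj1 assms(5) by (metis injD)
  then have 2: "\<pi> i = j" using 1 assms(6) by (simp add: \<pi>_def)
  show ?thesis
  proof (rule that)
    show "\<pi> permutes S" unfolding \<pi>_def
      by (intro permutes_compose[OF p1] permutes_swap_id) (use assms permutes_in_image[OF p1] in auto)
    show "\<pi> k = l" by (simp add: \<pi>_def)
    show "\<pi> i = j" by fact
    fix x assume x: "x \<noteq> i" "x \<noteq> k" "\<rho> x \<noteq> j" "\<rho> x \<noteq> l"
    have "\<rho> x \<noteq> \<rho> i" using x inj by (metis injD)
    then have e: "\<pi>1 x = \<rho> x" using x by (simp add: \<pi>1_def)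
    have "\<pi>1 x \<noteq> \<pi>1 k" using x inj1 by (metis injD)
    then show "\<pi> x = \<rho> x" using x e by (simp add: \<pi>_def)
  qed
qed

lemma card_coset1:
  assumes "i \<in> {1..n}" "j \<in> {1..n}"
  shows "card (coset1 n i j) = fact (n - 1)"
proof -
  have "coset1 n i j = {\<sigma>. \<sigma> permutes {1..n} \<and> (\<forall>x\<in>{i}. \<sigma> x = transpose i j x)}"
    by (auto simp: coset1_def Sym_def)
  then show ?thesis
    using card_permutes_agree[of "{1..n}" "transpose i j" "{i}"] assms
    by (simp add: permutes_swap_id)
qed

lemma card_two_values:
  assumes "i \<in> {1..n}" "j \<in> {1..n}" "k \<in> {1..n}" "l \<in> {1..n}" "i \<noteq> k" "j \<noteq> l"
  shows "card {\<sigma> \<in> Sym n. \<sigma> i = j \<and> \<sigma> k = l} = fact (n - 2)"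
proof -
  obtain \<pi> where p: "\<pi> permutes {1..n}" "\<pi> i = j" "\<pi> k = l"
    using permutes_with_two_values[OF assms permutes_id] by metis
  have "{\<sigma> \<in> Sym n. \<sigma> i = j \<and> \<sigma> k = l} = {\<sigma>. \<sigma> permutes {1..n} \<and> (\<forall>x\<in>{i,k}. \<sigma> x = \<pi> x)}"
    using p by (auto simp: Sym_def)
  then show ?thesis
    using card_permutes_agree[of "{1..n}" \<pi> "{i,k}"] assms p by (simp add: numeral_2_eq_2)
qed

lemma card_three_values_le:
  assumes "i \<in> {1..n}" "k \<in> {1..n}" "k' \<in> {1..n}" "i \<noteq> k" "i \<noteq> k'" "k \<noteq> k'"
  shows "card {\<sigma> \<in> Sym n. \<sigma> i = j \<and> \<sigma> k = l \<and> \<sigma> k' = l'} \<le> fact (n - 3)"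
proof (cases "{\<sigma> \<in> Sym n. \<sigma> i = j \<and> \<sigma> k = l \<and> \<sigma> k' = l'} = {}")
  case False
  then obtain \<pi> where p: "\<pi> permutes {1..n}" "\<pi> i = j" "\<pi> k = l" "\<pi> k' = l'"
    by (auto simp: Sym_def)
  have "{\<sigma> \<in> Sym n. \<sigma> i = j \<and> \<sigma> k = l \<and> \<sigma> k' = l'}
      = {\<sigma>. \<sigma> permutes {1..n} \<and> (\<forall>x\<in>{i,k,k'}. \<sigma> x = \<pi> x)}"
    using p by (auto simp: Sym_def)
  then show ?thesis
    using card_permutes_agree[of "{1..n}" \<pi> "{i,k,k'}"] assms p by (simp add: numeral_3_eq_3)
qed (metis card.empty zero_le)

section \<open>Derangement numbers and the permutations of a coset that miss a given one\<close>

lemma card_derangements_of_set: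
  assumes "finite S"
  shows "card {\<sigma>. \<sigma> permutes S \<and> (\<forall>k\<in>S. \<sigma> k \<noteq> k)} = derangements (card S)"
proof -
  obtain f where f: "bij_betw f {1..card S} S"
    using ex_bij_betw_nat_finite_1[OF assms] by blast
  show ?thesis unfolding derangements_def
    using bij_betw_same_card[OF bij_betw_derangements[OF f]] by simp
qed

lemma card_fixing_at_most_one:
  assumes "finite S" "j \<in> S"
  shows "card {\<sigma>. \<sigma> permutes S \<and> (\<forall>k\<in>S - {j}. \<sigma> k \<noteq> k)}
    = derangements (card S) + derangements (card S - 1)"
proof -
  let ?D = "{\<sigma>. \<sigma> permutes S \<and> (\<forall>k\<in>S. \<sigma> k \<noteq> k)}"
  let ?E = "{\<sigma>. \<sigma> permutes (S - {j}) \<and> (\<forall>k\<in>S - {j}. \<sigma> k \<noteq> k)}"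
  have "{\<sigma>. \<sigma> permutes S \<and> (\<forall>k\<in>S - {j}. \<sigma> k \<noteq> k)} = ?D \<union> ?E"
  proof (intro equalityI subsetI)
    fix \<sigma> assume s: "\<sigma> \<in> {\<sigma>. \<sigma> permutes S \<and> (\<forall>k\<in>S - {j}. \<sigma> k \<noteq> k)}"
    show "\<sigma> \<in> ?D \<union> ?E"
    proof (cases "\<sigma> j = j")
      case True
      have "\<sigma> permutes (S - {j})"
        by (rule permutes_superset[of \<sigma> S]) (use s True assms in auto)
      with s show ?thesis by auto
    qed (use s in auto)
  next
    fix \<sigma> assume "\<sigma> \<in> ?D \<union> ?E"
    then show "\<sigma> \<in> {\<sigma>. \<sigma> permutes S \<and> (\<forall>k\<in>S - {j}. \<sigma> k \<noteq> k)}"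
      using permutes_subset[of \<sigma> "S - {j}" S] by auto
  qed
  moreover have "?D \<inter> ?E = {}"
    using assms(2) permutes_not_in[of _ "S - {j}" j] by auto
  moreover have "finite ?D" "finite ?E"
    using finite_permutations[of S] finite_permutations[of "S - {j}"] assms(1) by simp_all
  ultimately show ?thesis
    using assms card_derangements_of_set[of S] card_derangements_of_set[of "S - {j}"]
    by (simp add: card_Un_disjoint)
qed

text \<open>Let \<open>j'\<close> be the point that \<open>\<rho>\<close> sends to \<open>j\<close>,
  and write \<open>\<sigma> = \<pi> \<circ> \<tau>\<close> with \<open>\<tau>\<close> fixing
  \<open>i\<close>. Agreement of \<open>\<sigma>\<close> and \<open>\<rho>\<close> at a point other
  than \<open>i\<close> and \<open>j'\<close> means a fixed point of \<open>\<tau>\<close>; at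
  \<open>j'\<close> it is impossible, because the value \<open>j\<close> is already taken at
  \<open>i\<close>. So \<open>\<tau>\<close> permutes n-1 points and only \<open>j'\<close> may be
  fixed, which gives the two derangement numbers.\<close>

lemma card_coset1_avoiding:
  assumes "i \<in> {1..n}" "j \<in> {1..n}" "\<rho> \<in> Sym n" "\<rho> i \<noteq> j"
  shows "card {\<sigma> \<in> coset1 n i j. \<not> perm_intersect n \<sigma> \<rho>} = derangements (n - 1) + derangements (n - 2)"
proof -
  have r: "\<rho> permutes {1..n}" using assms by (simp add: Sym_def)
  define j' where "j' = inv \<rho> j"
  have j': "\<rho> j' = j" "j' \<in> {1..n}"
    using permutes_inverses(1)[OF r] permutes_in_image[OF permutes_inv[OF r]] assms
    by (auto simp: j'_def)
  have ne: "j' \<noteq> i" using j' assms by auto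
  define \<pi> where "\<pi> = \<rho> \<circ> transpose i j'"
  have p: "\<pi> permutes {1..n}" unfolding \<pi>_def
    by (intro permutes_compose permutes_swap_id r) (use assms j' in auto)
  have pi: "\<pi> i = j" by (simp add: \<pi>_def j')
  have inj: "inj \<rho>" using r by (rule permutes_inj)
  have "{\<sigma> \<in> coset1 n i j. \<not> perm_intersect n \<sigma> \<rho>}
      = {\<sigma>. \<sigma> permutes {1..n} \<and> (\<forall>x\<in>{i}. \<sigma> x = \<pi> x) \<and> \<not> perm_intersect n \<sigma> \<rho>}"
    using pi by (auto simp: coset1_def Sym_def)
  then have "card {\<sigma> \<in> coset1 n i j. \<not> perm_intersect n \<sigma> \<rho>}
      = card {\<tau>. \<tau> permutes ({1..n} - {i}) \<and> \<not> perm_intersect n (\<pi> \<circ> \<tau>) \<rho>}"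
    using card_permutes_agree_and[OF p, of "{i}"] assms by simp
  also have "{\<tau>. \<tau> permutes ({1..n} - {i}) \<and> \<not> perm_intersect n (\<pi> \<circ> \<tau>) \<rho>}
     = {\<tau>. \<tau> permutes ({1..n} - {i}) \<and> (\<forall>k\<in>{1..n} - {i} - {j'}. \<tau> k \<noteq> k)}"
  proof (intro Collect_cong conj_cong refl)
    fix \<tau> assume t: "\<tau> permutes ({1..n} - {i})"
    have "(\<pi> \<circ> \<tau>) k = \<rho> k \<longleftrightarrow> k \<noteq> i \<and> k \<noteq> j' \<and> \<tau> k = k" if "k \<in> {1..n}" for k
    proof -
      have "(\<pi> \<circ> \<tau>) k = \<rho> k \<longleftrightarrow> transpose i j' (\<tau> k) = k"
        using inj by (auto simp: \<pi>_def inj_eq)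
      moreover have "\<tau> i = i" using permutes_not_in[OF t, of i] by simp
      moreover have "\<tau> k \<noteq> i" if "k \<noteq> i"
        using permutes_in_image[OF t, of k] that \<open>k \<in> {1..n}\<close> by auto
      moreover have "\<tau> k \<noteq> k" if "\<tau> k = j'" "k \<noteq> j'" using that by auto
      ultimately show ?thesis using ne by (auto simp: transpose_def)
    qed
    then show "(\<not> perm_intersect n (\<pi> \<circ> \<tau>) \<rho>) \<longleftrightarrow> (\<forall>k\<in>{1..n} - {i} - {j'}. \<tau> k \<noteq> k)"
      unfolding perm_intersect_def by blast
  qed
  also have "card \<dots> = derangements (n - 1) + derangements (n - 2)"
    using card_fixing_at_most_one[of "{1..n} - {i}" j'] assms j' ne by (simp add: numeral_2_eq_2)
  finally show ?thesis .
qed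

text \<open>Every derangement \<open>\<tau>\<close> of the remaining n-2 points yields a suitable
  \<open>\<pi> \<circ> \<tau>\<close>: an agreement with \<open>\<rho>\<close> at \<open>x\<close>
  would keep \<open>\<rho> x\<close> away from \<open>j\<close> and \<open>l\<close>, hence
  \<open>\<pi> x = \<rho> x\<close> and \<open>\<tau> x = x\<close>. Only a lower bound results,
  since points that \<open>\<rho>\<close> sends to \<open>j\<close> or \<open>l\<close> may be fixed
  by \<open>\<tau>\<close> as well.\<close>

lemma card_two_values_avoiding_ge:
  assumes "i \<in> {1..n}" "j \<in> {1..n}" "k \<in> {1..n}" "l \<in> {1..n}" "i \<noteq> k" "j \<noteq> l"
    and "\<rho> \<in> Sym n" "\<rho> i \<noteq> j" "\<rho> k \<noteq> l"
  shows "derangements (n - 2) \<le> card {\<sigma> \<in> Sym n. \<sigma> i = j \<and> \<sigma> k = l \<and> \<not> perm_intersect n \<sigma> \<rho>}"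
proof -
  have r: "\<rho> permutes {1..n}" using assms by (simp add: Sym_def)
  obtain \<pi> where p: "\<pi> permutes {1..n}" "\<pi> i = j" "\<pi> k = l"
    "\<And>x. x \<noteq> i \<Longrightarrow> x \<noteq> k \<Longrightarrow> \<rho> x \<noteq> j \<Longrightarrow> \<rho> x \<noteq> l \<Longrightarrow> \<pi> x = \<rho> x"
    using permutes_with_two_values[OF assms(1-6) r] by metis
  have inj: "inj \<pi>" using p(1) by (rule permutes_inj)
  have eq: "{\<sigma> \<in> Sym n. \<sigma> i = j \<and> \<sigma> k = l \<and> \<not> perm_intersect n \<sigma> \<rho>}
      = {\<sigma>. \<sigma> permutes {1..n} \<and> (\<forall>x\<in>{i,k}. \<sigma> x = \<pi> x) \<and> \<not> perm_intersect n \<sigma> \<rho>}"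
    using p by (auto simp: Sym_def)
  have "{\<tau>. \<tau> permutes ({1..n} - {i,k}) \<and> (\<forall>x\<in>{1..n} - {i,k}. \<tau> x \<noteq> x)}
     \<subseteq> {\<tau>. \<tau> permutes ({1..n} - {i,k}) \<and> \<not> perm_intersect n (\<pi> \<circ> \<tau>) \<rho>}"
  proof safe
    fix \<tau> assume t: "\<tau> permutes ({1..n} - {i,k})" "\<forall>x\<in>{1..n} - {i,k}. \<tau> x \<noteq> x"
      "perm_intersect n (\<pi> \<circ> \<tau>) \<rho>"
    then obtain x where x: "x \<in> {1..n}" "\<pi> (\<tau> x) = \<rho> x" by (auto simp: perm_intersect_def)
    have f: "\<tau> i = i" "\<tau> k = k" using permutes_not_in[OF t(1)] by auto
    have xn: "x \<noteq> i" "x \<noteq> k" using x f p assms by auto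
    then have "\<tau> x \<noteq> i" "\<tau> x \<noteq> k"
      using permutes_inj[OF t(1)] f by (metis injD)+
    then have "\<rho> x \<noteq> j" "\<rho> x \<noteq> l" using x p inj by (metis injD)+
    then have "\<pi> x = \<rho> x" using p(4) xn by blast
    then have "\<tau> x = x" using x inj by (metis injD)
    then show False using t x xn by auto
  qed
  moreover have "finite {\<tau>. \<tau> permutes ({1..n} - {i,k}) \<and> \<not> perm_intersect n (\<pi> \<circ> \<tau>) \<rho>}"
    using finite_permutations[of "{1..n} - {i,k}"] by (auto intro: finite_subset)
  ultimately have "card {\<tau>. \<tau> permutes ({1..n} - {i,k}) \<and> (\<forall>x\<in>{1..n} - {i,k}. \<tau> x \<noteq> x)}
     \<le> card {\<tau>. \<tau> permutes ({1..n} - {i,k}) \<and> \<not> perm_intersect n (\<pi> \<circ> \<tau>) \<rho>}"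
    by (rule card_mono[rotated])
  moreover have "card ({1..n} - {i,k}) = n - 2"
    using assms by (simp add: card_Diff_subset)
  ultimately show ?thesis
    using card_derangements_of_set[of "{1..n} - {i,k}"]
      card_permutes_agree_and[OF p(1), of "{i,k}"] assms eq by simp
qed

text \<open>Classifying derangements by the image of 1 gives n-1 classes, each of them the case
  \<open>\<rho> = id\<close> of \<open>card_coset1_avoiding\<close>.\<close>

lemma derangements_rec:
  assumes "n \<ge> 2"
  shows "derangements n = (n - 1) * (derangements (n - 1) + derangements (n - 2))"
proof -
  let ?E = "\<lambda>j. {\<sigma> \<in> coset1 n 1 j. \<not> perm_intersect n \<sigma> id}"
  have one: "1 \<in> {1..n}" using assms by auto
  have "{\<sigma>. \<sigma> permutes {1..n} \<and> (\<forall>k\<in>{1..n}. \<sigma> k \<noteq> k)} = (\<Union>j\<in>{2..n}. ?E j)"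
  proof (intro equalityI subsetI)
    fix \<sigma> assume s: "\<sigma> \<in> {\<sigma>. \<sigma> permutes {1..n} \<and> (\<forall>k\<in>{1..n}. \<sigma> k \<noteq> k)}"
    then have "\<sigma> 1 \<in> {1..n}" using permutes_in_image[of \<sigma> "{1..n}" 1] one by auto
    moreover have "\<sigma> 1 \<noteq> 1" using s one by auto
    ultimately have "\<sigma> 1 \<in> {2..n}" by auto
    with s show "\<sigma> \<in> (\<Union>j\<in>{2..n}. ?E j)"
      by (auto simp: coset1_def Sym_def perm_intersect_def)
  qed (auto simp: coset1_def Sym_def perm_intersect_def)
  moreover have "card (\<Union>j\<in>{2..n}. ?E j) = (\<Sum>j\<in>{2..n}. card (?E j))"
  proof (rule card_UN_disjoint)
    show "\<forall>j\<in>{2..n}. finite (?E j)"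
      by (auto intro!: finite_subset[OF _ finite_Sym[of n]] simp: coset1_def)
  qed (auto simp: coset1_def)
  moreover have "(\<Sum>j\<in>{2..n}. card (?E j)) = (\<Sum>j\<in>{2..n}. derangements (n - 1) + derangements (n - 2))"
    by (intro sum.cong refl card_coset1_avoiding) (use one in \<open>auto simp: Sym_def permutes_id\<close>)
  ultimately show ?thesis
    using assms by (simp add: derangements_def[of n] eval_nat_numeral)
qed

lemma derangements_0: "derangements 0 = 1" and derangements_1: "derangements (Suc 0) = 0"
proof -
  have "{\<sigma>. \<sigma> permutes {1..0::nat} \<and> (\<forall>k\<in>{1..0}. \<sigma> k \<noteq> k)} = {id}" by auto
  then show "derangements 0 = 1" unfolding derangements_def by simp
  have "{\<sigma>. \<sigma> permutes {1..Suc 0} \<and> (\<forall>k\<in>{1..Suc 0}. \<sigma> k \<noteq> k)} = {}" by auto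
  then show "derangements (Suc 0) = 0" unfolding derangements_def by (simp only: card.empty)
qed

text \<open>\<open>fact\<close> obeys the same two-term recurrence as \<open>derangements\<close>,
  so both inequalities propagate from n = 2 and n = 3. They stand in for the limiting ratio
  1/e.\<close>

lemma derangements_bounds:
  assumes "n \<ge> 2"
  shows "fact n \<le> 3 * derangements n" "2 * derangements n \<le> fact n"
proof -
  have d2: "derangements 2 = 1"
    using derangements_rec[of 2] derangements_0 derangements_1 by simp
  have d3: "derangements 3 = 2"
    using derangements_rec[of 3] d2 derangements_1 by simp
  have "fact n \<le> 3 * derangements n \<and> 2 * derangements n \<le> fact n"
    using assms
  proof (induction n rule: less_induct)
    case (less n)
    consider "n = 2" | "n = 3" | "n \<ge> 4" using less.prems by linarith
    then show ?case
    proof cases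
      case 3
      then obtain m where n: "n = m + 2" "m \<ge> 2"
        using le_iff_add[of 2 n] by (metis add.commute add_le_cancel_right less.prems numeral_Bit0)
      have e: "derangements n = (m + 1) * (derangements (m + 1) + derangements m)"
        using derangements_rec[of n] n by simp
      have f: "fact n = (m + 1) * (fact (m + 1) + fact m)" by (simp add: n algebra_simps)
      have "fact (m+1) \<le> 3 * derangements (m+1) \<and> 2 * derangements (m+1) \<le> fact (m+1)"
        "fact m \<le> 3 * derangements m \<and> 2 * derangements m \<le> fact m"
        using less.IH[of "m+1"] less.IH[of m] n by auto
      then have "fact (m+1) + fact m \<le> 3 * (derangements (m+1) + derangements m)"
        "2 * (derangements (m+1) + derangements m) \<le> fact (m+1) + fact m" by auto
      then have "(m+1) * (fact (m+1) + fact m) \<le> (m+1) * (3 * (derangements (m+1) + derangements m))"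
        "(m+1) * (2 * (derangements (m+1) + derangements m)) \<le> (m+1) * (fact (m+1) + fact m)"
        by (meson mult_le_mono2)+
      then show ?thesis unfolding e f by (simp only: mult.left_commute[of "m+1"] simp_thms)
    qed (auto simp: d2 d3 fact_numeral)
  qed
  then show "fact n \<le> 3 * derangements n" "2 * derangements n \<le> fact n" by auto
qed

section \<open>The form of cell counts\<close>

declare One_nat_def [simp del]

definition agree :: "nat \<Rightarrow> (nat \<Rightarrow> nat) \<Rightarrow> (nat \<Rightarrow> nat) \<Rightarrow> nat" where
  "agree n \<sigma> \<tau> = card {k \<in> {1..n}. \<sigma> k = \<tau> k}"

definition cell :: "nat \<Rightarrow> ((nat \<Rightarrow> nat) \<Rightarrow> real) \<Rightarrow> nat \<Rightarrow> nat \<Rightarrow> real" where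
  "cell n f i j = (\<Sum>\<sigma>\<in>coset1 n i j. f \<sigma>)"

lemma Sym_in_image: "\<sigma> \<in> Sym n \<Longrightarrow> i \<in> {1..n} \<Longrightarrow> \<sigma> i \<in> {1..n}"
  unfolding Sym_def by (metis mem_Collect_eq permutes_in_image)

lemma Sym_inj: "\<sigma> \<in> Sym n \<Longrightarrow> \<sigma> i = \<sigma> k \<longleftrightarrow> i = k"
  unfolding Sym_def by (metis mem_Collect_eq permutes_inj injD)

lemma finite_coset1 [simp]: "finite (coset1 n i j)"
  by (rule finite_subset[OF _ finite_Sym[of n]]) (auto simp: coset1_def)

lemma cell_altdef: "cell n f i j = (\<Sum>\<sigma>\<in>Sym n. if \<sigma> i = j then f \<sigma> else 0)"
  unfolding cell_def coset1_def by (simp add: sum.inter_filter)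

text \<open>Adjointness: sending weights \<open>w\<close> to the function
  \<open>\<Sum>i. w i (\<sigma> i)\<close> of \<open>\<sigma>\<close> is the transpose of sending
  \<open>f\<close> to its cell sums. It turns expressions in the cells into inner products with
  \<open>f\<close>.\<close>

lemma sum_weighted_cells:
  "(\<Sum>i\<in>{1..n}. \<Sum>j\<in>{1..n}. w i j * cell n f i j) = (\<Sum>\<sigma>\<in>Sym n. f \<sigma> * (\<Sum>i\<in>{1..n}. w i (\<sigma> i)))"
proof -
  have "(\<Sum>j\<in>{1..n}. w i j * cell n f i j) = (\<Sum>\<sigma>\<in>Sym n. f \<sigma> * w i (\<sigma> i))" if "i \<in> {1..n}" for i
  proof -
    have "(\<Sum>j\<in>{1..n}. w i j * cell n f i j)
        = (\<Sum>j\<in>{1..n}. \<Sum>\<sigma>\<in>Sym n. if \<sigma> i = j then f \<sigma> * w i j else 0)"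
      unfolding cell_altdef by (intro sum.cong refl) (auto simp: sum_distrib_left intro!: sum.cong)
    also have "\<dots> = (\<Sum>\<sigma>\<in>Sym n. \<Sum>j\<in>{1..n}. if \<sigma> i = j then f \<sigma> * w i j else 0)"
      by (rule sum.swap)
    also have "\<dots> = (\<Sum>\<sigma>\<in>Sym n. f \<sigma> * w i (\<sigma> i))"
      using Sym_in_image that by (intro sum.cong refl) (simp add: sum.delta')
    finally show ?thesis .
  qed
  then have "(\<Sum>i\<in>{1..n}. \<Sum>j\<in>{1..n}. w i j * cell n f i j) = (\<Sum>i\<in>{1..n}. \<Sum>\<sigma>\<in>Sym n. f \<sigma> * w i (\<sigma> i))"
    by (intro sum.cong refl) auto
  also have "\<dots> = (\<Sum>\<sigma>\<in>Sym n. f \<sigma> * (\<Sum>i\<in>{1..n}. w i (\<sigma> i)))"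
    by (subst sum.swap) (simp add: sum_distrib_left)
  finally show ?thesis .
qed

lemma sum_cell_row:
  assumes "i \<in> {1..n}"
  shows "(\<Sum>j\<in>{1..n}. cell n f i j) = (\<Sum>\<sigma>\<in>Sym n. f \<sigma>)"
proof -
  have "(\<Sum>j\<in>{1..n}. cell n f i j) = (\<Sum>\<sigma>\<in>Sym n. \<Sum>j\<in>{1..n}. if \<sigma> i = j then f \<sigma> else 0)"
    unfolding cell_altdef by (rule sum.swap)
  also have "\<dots> = (\<Sum>\<sigma>\<in>Sym n. f \<sigma>)"
    using Sym_in_image assms by (intro sum.cong refl) (simp add: sum.delta')
  finally show ?thesis .
qed

lemma sum_cell_column:
  assumes "j \<in> {1..n}"
  shows "(\<Sum>i\<in>{1..n}. cell n f i j) = (\<Sum>\<sigma>\<in>Sym n. f \<sigma>)"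
proof -
  have "(\<Sum>i\<in>{1..n}. cell n f i j) = (\<Sum>\<sigma>\<in>Sym n. \<Sum>i\<in>{1..n}. if \<sigma> i = j then f \<sigma> else 0)"
    unfolding cell_altdef by (rule sum.swap)
  also have "\<dots> = (\<Sum>\<sigma>\<in>Sym n. f \<sigma>)"
  proof (intro sum.cong refl)
    fix \<sigma> assume "\<sigma> \<in> Sym n"
    then have p: "\<sigma> permutes {1..n}" by (simp add: Sym_def)
    have "inv \<sigma> j \<in> {1..n}" using permutes_in_image[OF permutes_inv[OF p]] assms by simp
    moreover have "\<sigma> i = j \<longleftrightarrow> i = inv \<sigma> j" for i
      using permutes_inverses[OF p] by metis
    ultimately show "(\<Sum>i\<in>{1..n}. if \<sigma> i = j then f \<sigma> else 0) = f \<sigma>" by simp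
  qed
  finally show ?thesis .
qed

section \<open>Second moments of sums of matrix entries along a permutation\<close>

lemma sum_Sym_one_value:
  fixes g :: "nat \<Rightarrow> real"
  assumes "i \<in> {1..n}"
  shows "(\<Sum>\<sigma>\<in>Sym n. g (\<sigma> i)) = fact (n - 1) * (\<Sum>j\<in>{1..n}. g j)"
proof -
  have "(\<Sum>\<sigma>\<in>Sym n. g (\<sigma> i)) = (\<Sum>j\<in>{1..n}. \<Sum>\<sigma>\<in>{\<sigma> \<in> Sym n. \<sigma> i = j}. g (\<sigma> i))"
    using Sym_in_image assms by (intro sum.group[symmetric]) auto
  also have "\<dots> = (\<Sum>j\<in>{1..n}. fact (n - 1) * g j)"
    using card_coset1[OF assms] by (intro sum.cong refl) (simp add: coset1_def)
  finally show ?thesis by (simp add: sum_distrib_left)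
qed

lemma sum_Sym_two_values:
  fixes g :: "nat \<Rightarrow> nat \<Rightarrow> real"
  assumes "i \<in> {1..n}" "k \<in> {1..n}" "i \<noteq> k"
  shows "(\<Sum>\<sigma>\<in>Sym n. g (\<sigma> i) (\<sigma> k)) = fact (n - 2) * (\<Sum>j\<in>{1..n}. \<Sum>l\<in>{1..n} - {j}. g j l)"
proof -
  let ?T = "SIGMA j:{1..n}. {1..n} - {j}"
  have "(\<Sum>\<sigma>\<in>Sym n. g (\<sigma> i) (\<sigma> k))
      = (\<Sum>z\<in>?T. \<Sum>\<sigma>\<in>{\<sigma> \<in> Sym n. (\<sigma> i, \<sigma> k) = z}. g (\<sigma> i) (\<sigma> k))"
    using Sym_in_image Sym_inj assms
    by (intro sum.group[symmetric]) (auto simp: image_subset_iff Sym_inj simp del: atLeastAtMost_iff)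
  also have "\<dots> = (\<Sum>z\<in>?T. fact (n - 2) * g (fst z) (snd z))"
  proof (intro sum.cong refl)
    fix z assume z: "z \<in> ?T"
    obtain j l where [simp]: "z = (j, l)" by force
    have "card {\<sigma> \<in> Sym n. \<sigma> i = j \<and> \<sigma> k = l} = fact (n - 2)"
      using z assms by (intro card_two_values) auto
    then show "(\<Sum>\<sigma>\<in>{\<sigma> \<in> Sym n. (\<sigma> i, \<sigma> k) = z}. g (\<sigma> i) (\<sigma> k)) = fact (n - 2) * g (fst z) (snd z)"
      by simp
  qed
  also have "\<dots> = (\<Sum>j\<in>{1..n}. \<Sum>l\<in>{1..n} - {j}. fact (n - 2) * g j l)"
    by (subst sum.Sigma) (auto simp: case_prod_unfold)
  finally show ?thesis by (simp add: sum_distrib_left)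
qed

lemma sum_Sym_pairs:
  fixes w :: "nat \<Rightarrow> nat \<Rightarrow> real"
  shows "(\<Sum>\<sigma>\<in>Sym n. (\<Sum>i\<in>{1..n}. w i (\<sigma> i))\<^sup>2)
    = fact (n - 1) * (\<Sum>i\<in>{1..n}. \<Sum>j\<in>{1..n}. (w i j)\<^sup>2)
    + fact (n - 2) * (\<Sum>i\<in>{1..n}. \<Sum>k\<in>{1..n} - {i}. \<Sum>j\<in>{1..n}. \<Sum>l\<in>{1..n} - {j}. w i j * w k l)"
proof -
  have "(\<Sum>\<sigma>\<in>Sym n. (\<Sum>i\<in>{1..n}. w i (\<sigma> i))\<^sup>2)
      = (\<Sum>\<sigma>\<in>Sym n. \<Sum>i\<in>{1..n}. \<Sum>k\<in>{1..n}. w i (\<sigma> i) * w k (\<sigma> k))"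
    by (simp add: power2_eq_square sum_product)
  also have "\<dots> = (\<Sum>i\<in>{1..n}. \<Sum>\<sigma>\<in>Sym n. \<Sum>k\<in>{1..n}. w i (\<sigma> i) * w k (\<sigma> k))"
    by (rule sum.swap)
  also have "\<dots> = (\<Sum>i\<in>{1..n}. \<Sum>k\<in>{1..n}. \<Sum>\<sigma>\<in>Sym n. w i (\<sigma> i) * w k (\<sigma> k))"
    by (intro sum.cong refl sum.swap)
  also have "\<dots> = (\<Sum>i\<in>{1..n}. fact (n - 1) * (\<Sum>j\<in>{1..n}. (w i j)\<^sup>2)
     + (\<Sum>k\<in>{1..n} - {i}. fact (n - 2) * (\<Sum>j\<in>{1..n}. \<Sum>l\<in>{1..n} - {j}. w i j * w k l)))"
  proof (rule sum.cong[OF refl])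
    fix i assume i: "i \<in> {1..n}"
    have "(\<Sum>k\<in>{1..n}. \<Sum>\<sigma>\<in>Sym n. w i (\<sigma> i) * w k (\<sigma> k))
      = (\<Sum>\<sigma>\<in>Sym n. w i (\<sigma> i) * w i (\<sigma> i))
        + (\<Sum>k\<in>{1..n} - {i}. \<Sum>\<sigma>\<in>Sym n. w i (\<sigma> i) * w k (\<sigma> k))"
      using i by (subst sum.remove[of _ i]) auto
    also have "(\<Sum>\<sigma>\<in>Sym n. w i (\<sigma> i) * w i (\<sigma> i)) = fact (n - 1) * (\<Sum>j\<in>{1..n}. (w i j)\<^sup>2)"
      using sum_Sym_one_value[OF i, of "\<lambda>j. w i j * w i j"] by (simp add: power2_eq_square)
    also have "(\<Sum>k\<in>{1..n} - {i}. \<Sum>\<sigma>\<in>Sym n. w i (\<sigma> i) * w k (\<sigma> k))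
      = (\<Sum>k\<in>{1..n} - {i}. fact (n - 2) * (\<Sum>j\<in>{1..n}. \<Sum>l\<in>{1..n} - {j}. w i j * w k l))"
      using i by (intro sum.cong refl sum_Sym_two_values) auto
    finally show "(\<Sum>k\<in>{1..n}. \<Sum>\<sigma>\<in>Sym n. w i (\<sigma> i) * w k (\<sigma> k))
      = fact (n - 1) * (\<Sum>j\<in>{1..n}. (w i j)\<^sup>2)
     + (\<Sum>k\<in>{1..n} - {i}. fact (n - 2) * (\<Sum>j\<in>{1..n}. \<Sum>l\<in>{1..n} - {j}. w i j * w k l))" .
  qed
  finally show ?thesis by (simp add: sum.distrib sum_distrib_left)
qed

lemma sum_Sym_sq_le:
  fixes w :: "nat \<Rightarrow> nat \<Rightarrow> real"
  assumes "\<And>i j. w i j \<ge> 0"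
  shows "(\<Sum>\<sigma>\<in>Sym n. (\<Sum>i\<in>{1..n}. w i (\<sigma> i))\<^sup>2)
    \<le> fact (n - 1) * (\<Sum>i\<in>{1..n}. \<Sum>j\<in>{1..n}. (w i j)\<^sup>2)
    + fact (n - 2) * (\<Sum>i\<in>{1..n}. \<Sum>j\<in>{1..n}. w i j)\<^sup>2"
proof -
  have "(\<Sum>i\<in>{1..n}. \<Sum>k\<in>{1..n} - {i}. \<Sum>j\<in>{1..n}. \<Sum>l\<in>{1..n} - {j}. w i j * w k l)
     \<le> (\<Sum>i\<in>{1..n}. \<Sum>k\<in>{1..n}. \<Sum>j\<in>{1..n}. \<Sum>l\<in>{1..n}. w i j * w k l)"
    by (intro sum_mono order.trans[OF sum_mono sum_mono2])
      (auto intro!: sum_mono2 sum_nonneg mult_nonneg_nonneg assms)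
  also have "\<dots> = (\<Sum>i\<in>{1..n}. \<Sum>j\<in>{1..n}. w i j)\<^sup>2"
    by (simp add: power2_eq_square sum_product)
  finally show ?thesis unfolding sum_Sym_pairs by (simp add: mult_left_mono)
qed

text \<open>The mixed term collapses: summing over \<open>l \<noteq> j\<close> leaves
  \<open>- u k j\<close>, summing that over \<open>k \<noteq> i\<close> leaves \<open>u i j\<close>.
  Mixed and diagonal terms become the same sum of squares, with total coefficient (n-1)! + (n-2)! =
  n!/(n-1).\<close>

lemma sum_Sym_sq_zero_marginals:
  fixes u :: "nat \<Rightarrow> nat \<Rightarrow> real"
  assumes row: "\<And>i. i \<in> {1..n} \<Longrightarrow> (\<Sum>j\<in>{1..n}. u i j) = 0"
    and col: "\<And>j. j \<in> {1..n} \<Longrightarrow> (\<Sum>i\<in>{1..n}. u i j) = 0"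
    and n: "n \<ge> 2"
  shows "(\<Sum>\<sigma>\<in>Sym n. (\<Sum>i\<in>{1..n}. u i (\<sigma> i))\<^sup>2)
    = fact n / (real n - 1) * (\<Sum>i\<in>{1..n}. \<Sum>j\<in>{1..n}. (u i j)\<^sup>2)"
proof -
  have "(\<Sum>k\<in>{1..n} - {i}. \<Sum>j\<in>{1..n}. \<Sum>l\<in>{1..n} - {j}. u i j * u k l) = (\<Sum>j\<in>{1..n}. (u i j)\<^sup>2)"
    if i: "i \<in> {1..n}" for i
  proof -
    have "(\<Sum>k\<in>{1..n} - {i}. \<Sum>j\<in>{1..n}. \<Sum>l\<in>{1..n} - {j}. u i j * u k l)
        = (\<Sum>k\<in>{1..n} - {i}. \<Sum>j\<in>{1..n}. u i j * (- u k j))"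
    proof (intro sum.cong refl)
      fix k j assume k: "k \<in> {1..n} - {i}" and j: "j \<in> {1..n}"
      have "(\<Sum>l\<in>{1..n} - {j}. u k l) = - u k j"
        using row[of k] k j sum.remove[of "{1..n}" j "u k"] by simp
      then show "(\<Sum>l\<in>{1..n} - {j}. u i j * u k l) = u i j * (- u k j)"
        by (simp flip: sum_distrib_left)
    qed
    also have "\<dots> = (\<Sum>j\<in>{1..n}. \<Sum>k\<in>{1..n} - {i}. u i j * (- u k j))" by (rule sum.swap)
    also have "\<dots> = (\<Sum>j\<in>{1..n}. (u i j)\<^sup>2)"
    proof (intro sum.cong refl)
      fix j assume j: "j \<in> {1..n}"
      have "(\<Sum>k\<in>{1..n} - {i}. u k j) = - u i j"
        using col[OF j] i sum.remove[of "{1..n}" i "\<lambda>k. u k j"] by simp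
      then show "(\<Sum>k\<in>{1..n} - {i}. u i j * (- u k j)) = (u i j)\<^sup>2"
        by (simp add: power2_eq_square sum_negf flip: sum_distrib_left)
    qed
    finally show ?thesis .
  qed
  then have "(\<Sum>i\<in>{1..n}. \<Sum>k\<in>{1..n} - {i}. \<Sum>j\<in>{1..n}. \<Sum>l\<in>{1..n} - {j}. u i j * u k l)
      = (\<Sum>i\<in>{1..n}. \<Sum>j\<in>{1..n}. (u i j)\<^sup>2)"
    by (rule sum.cong[OF refl])
  moreover have "fact (n - 1) + fact (n - 2) = fact n / (real n - 1)"
  proof -
    obtain m where m: "n = Suc (Suc m)" using n by (metis add_2_eq_Suc le_Suc_ex)
    show ?thesis unfolding m by (simp add: field_simps)
  qed
  ultimately show ?thesis unfolding sum_Sym_pairs by (simp flip: distrib_right)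
qed

text \<open>The kernel of this form is the number of agreements minus 1: see \<open>sum_agree\<close>.\<close>

definition cell_form :: "nat \<Rightarrow> ((nat \<Rightarrow> nat) \<Rightarrow> real) \<Rightarrow> ((nat \<Rightarrow> nat) \<Rightarrow> real) \<Rightarrow> real" where
  "cell_form n f g = (\<Sum>i\<in>{1..n}. \<Sum>j\<in>{1..n}. cell n f i j * cell n g i j)
     - (\<Sum>\<sigma>\<in>Sym n. f \<sigma>) * (\<Sum>\<sigma>\<in>Sym n. g \<sigma>)"

section \<open>The form as a multiple of an orthogonal projection\<close>

definition cell_dev :: "nat \<Rightarrow> ((nat \<Rightarrow> nat) \<Rightarrow> real) \<Rightarrow> nat \<Rightarrow> nat \<Rightarrow> real" where
  "cell_dev n f i j = cell n f i j - (\<Sum>\<sigma>\<in>Sym n. f \<sigma>) / real n"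

lemma sum_cell_dev_row: "i \<in> {1..n} \<Longrightarrow> (\<Sum>j\<in>{1..n}. cell_dev n f i j) = 0"
  unfolding cell_dev_def by (simp add: sum_subtractf sum_cell_row)

lemma sum_cell_dev_column: "j \<in> {1..n} \<Longrightarrow> (\<Sum>i\<in>{1..n}. cell_dev n f i j) = 0"
  unfolding cell_dev_def by (simp add: sum_subtractf sum_cell_column)

text \<open>Centring one factor already subtracts the product of the two sums, because the cells of
  \<open>g\<close> add up to \<open>n\<close> times the sum of \<open>g\<close>. This half-centred
  version is the one that \<open>sum_weighted_cells\<close> converts into an inner product with a
  single function.\<close>

lemma sum_cell_dev_cell:
  assumes "n \<ge> 1"
  shows "(\<Sum>i\<in>{1..n}. \<Sum>j\<in>{1..n}. cell_dev n f i j * cell n g i j) = cell_form n f g"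
proof -
  have "(\<Sum>i\<in>{1..n}. \<Sum>j\<in>{1..n}. cell_dev n f i j * cell n g i j)
     = (\<Sum>i\<in>{1..n}. \<Sum>j\<in>{1..n}. cell n f i j * cell n g i j)
       - (\<Sum>\<sigma>\<in>Sym n. f \<sigma>) / real n * (\<Sum>i\<in>{1..n}. \<Sum>j\<in>{1..n}. cell n g i j)"
    unfolding cell_dev_def left_diff_distrib sum_subtractf sum_distrib_left[symmetric] ..
  also have "(\<Sum>i\<in>{1..n}. \<Sum>j\<in>{1..n}. cell n g i j) = real n * (\<Sum>\<sigma>\<in>Sym n. g \<sigma>)"
    by (simp add: sum_cell_row)
  finally show ?thesis using assms by (simp add: cell_form_def)
qed

lemma cell_form_eq_dev:
  assumes "n \<ge> 1"
  shows "cell_form n f g = (\<Sum>i\<in>{1..n}. \<Sum>j\<in>{1..n}. cell_dev n f i j * cell_dev n g i j)"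
proof -
  have "(\<Sum>i\<in>{1..n}. \<Sum>j\<in>{1..n}. cell_dev n f i j * cell_dev n g i j)
     = (\<Sum>i\<in>{1..n}. \<Sum>j\<in>{1..n}. cell_dev n f i j * cell n g i j)
       - (\<Sum>\<sigma>\<in>Sym n. g \<sigma>) / real n * (\<Sum>i\<in>{1..n}. \<Sum>j\<in>{1..n}. cell_dev n f i j)"
    unfolding cell_dev_def[of n g] right_diff_distrib sum_subtractf sum_distrib_right[symmetric]
    by (simp only: mult.commute)
  then show ?thesis using assms by (simp add: sum_cell_dev_row sum_cell_dev_cell)
qed

lemma cell_form_nonneg: "n \<ge> 1 \<Longrightarrow> cell_form n f f \<ge> 0"
  by (simp add: cell_form_eq_dev sum_nonneg)

text \<open>A self-improving estimate. Let h be the sum of the deviations of \<open>f\<close> along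
  a permutation, S the value of the form and K = n!/(n-1). Then S is the inner product of
  \<open>f\<close> and h, while h has squared norm K S because its weights have zero marginals.
  Cauchy-Schwarz bounds S^2 by K S times the squared norm of \<open>f\<close>, and S cancels. Behind
  this, the kernel is K times an orthogonal projection.\<close>

lemma cell_form_upper:
  assumes n: "n \<ge> 2"
  shows "cell_form n f f \<le> fact n / (real n - 1) * (\<Sum>\<sigma>\<in>Sym n. (f \<sigma>)\<^sup>2)"
proof -
  let ?u = "cell_dev n f" and ?K = "fact n / (real n - 1)"
  let ?S = "cell_form n f f"
  have K: "?K > 0" using n by simp
  have S: "?S = (\<Sum>i\<in>{1..n}. \<Sum>j\<in>{1..n}. (?u i j)\<^sup>2)"
    using n by (simp add: cell_form_eq_dev power2_eq_square)
  have "?S = (\<Sum>\<sigma>\<in>Sym n. f \<sigma> * (\<Sum>i\<in>{1..n}. ?u i (\<sigma> i)))"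
    using n sum_cell_dev_cell[of n f f] by (simp add: sum_weighted_cells)
  then have "?S\<^sup>2 \<le> (\<Sum>\<sigma>\<in>Sym n. (f \<sigma>)\<^sup>2) * (\<Sum>\<sigma>\<in>Sym n. (\<Sum>i\<in>{1..n}. ?u i (\<sigma> i))\<^sup>2)"
    using Cauchy_Schwarz_ineq_sum[of f _ "Sym n"] by simp
  also have "(\<Sum>\<sigma>\<in>Sym n. (\<Sum>i\<in>{1..n}. ?u i (\<sigma> i))\<^sup>2) = ?K * ?S"
    unfolding S using n by (intro sum_Sym_sq_zero_marginals sum_cell_dev_row sum_cell_dev_column)
  finally have *: "?S * ?S \<le> (?K * (\<Sum>\<sigma>\<in>Sym n. (f \<sigma>)\<^sup>2)) * ?S"
    by (simp add: power2_eq_square mult.commute mult.left_commute)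
  show ?thesis
  proof (cases "?S > 0")
    case True
    then show ?thesis using * by (rule mult_right_le_imp_le[rotated])
  next
    case False
    moreover have "?K * (\<Sum>\<sigma>\<in>Sym n. (f \<sigma>)\<^sup>2) \<ge> 0" using K by (intro mult_nonneg_nonneg sum_nonneg) auto
    ultimately show ?thesis by linarith
  qed
qed

lemma cell_add: "cell n (\<lambda>\<sigma>. f \<sigma> + g \<sigma>) i j = cell n f i j + cell n g i j"
  and cell_diff: "cell n (\<lambda>\<sigma>. f \<sigma> - g \<sigma>) i j = cell n f i j - cell n g i j"
  and cell_scale: "cell n (\<lambda>\<sigma>. c * f \<sigma>) i j = c * cell n f i j"
  unfolding cell_def by (simp_all add: sum.distrib sum_subtractf sum_distrib_left)

lemma cell_form_polarization:
  "4 * cell_form n f g = cell_form n (\<lambda>\<sigma>. f \<sigma> + g \<sigma>) (\<lambda>\<sigma>. f \<sigma> + g \<sigma>)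
     - cell_form n (\<lambda>\<sigma>. f \<sigma> - g \<sigma>) (\<lambda>\<sigma>. f \<sigma> - g \<sigma>)"
proof -
  have "(\<Sum>i\<in>{1..n}. \<Sum>j\<in>{1..n}. cell n (\<lambda>\<sigma>. f \<sigma> + g \<sigma>) i j * cell n (\<lambda>\<sigma>. f \<sigma> + g \<sigma>) i j)
    - (\<Sum>i\<in>{1..n}. \<Sum>j\<in>{1..n}. cell n (\<lambda>\<sigma>. f \<sigma> - g \<sigma>) i j * cell n (\<lambda>\<sigma>. f \<sigma> - g \<sigma>) i j)
    = 4 * (\<Sum>i\<in>{1..n}. \<Sum>j\<in>{1..n}. cell n f i j * cell n g i j)"
    unfolding cell_add cell_diff sum_subtractf[symmetric] sum_distrib_left
    by (intro sum.cong refl) (simp add: algebra_simps)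
  then show ?thesis unfolding cell_form_def
    by (simp add: sum.distrib sum_subtractf algebra_simps)
qed

lemma cell_form_scale: "cell_form n (\<lambda>\<sigma>. c * f \<sigma>) (\<lambda>\<sigma>. d * g \<sigma>) = c * d * cell_form n f g"
  unfolding cell_form_def cell_scale
  by (simp add: sum_distrib_left algebra_simps flip: sum_distrib_left)

text \<open>Polarization, dropping one of the two squares by semidefiniteness and bounding the other
  by \<open>cell_form_upper\<close>. In the lower bound the cross term of (f - g)^2 has a favourable
  sign because indicators are nonnegative; this gives the constant 1/4 where Cauchy-Schwarz would
  give 1/2, a saving on which the whole argument depends. The weight \<open>t\<close> serves to
  balance families of very different sizes.\<close>

lemma cell_form_indicator_bounds:
  fixes t :: real
  assumes n: "n \<ge> 2" and AB: "A \<subseteq> Sym n" "B \<subseteq> Sym n" and t: "t > 0"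
  shows "cell_form n (indicator A) (indicator B)
      \<ge> - (fact n / (4 * (real n - 1)) * (t * card A + card B / t))"
    and "cell_form n (indicator A) (indicator B)
      \<le> fact n / (2 * (real n - 1)) * (t * card A + card B / t)"
proof -
  \<comment> \<open>Scaling the indicators by \<open>s\<close> and \<open>1 / s\<close> leaves the
    form unchanged and multiplies the squared norms by \<open>t\<close> and
    \<open>1 / t\<close>.\<close>
  define s where "s = sqrt t"
  have s: "s > 0" "s * s = t" using t by (auto simp: s_def)
  define f where "f = (\<lambda>\<sigma>. s * indicator A \<sigma> :: real)"
  define g where "g = (\<lambda>\<sigma>. 1 / s * indicator B \<sigma> :: real)"
  define K where "K = fact n / (real n - 1)"
  define E where "E = t * card A + card B / t"
  have K: "K > 0" using n by (simp add: K_def)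
  have eq: "cell_form n f g = cell_form n (indicator A) (indicator B)"
    unfolding f_def g_def cell_form_scale using s by simp
  have card: "(\<Sum>\<sigma>\<in>Sym n. (indicator C \<sigma>)\<^sup>2) = real (card C)" if "C \<subseteq> Sym n" for C
  proof -
    have "(\<Sum>\<sigma>\<in>Sym n. (indicator C \<sigma>)\<^sup>2) = (\<Sum>\<sigma>\<in>Sym n. indicator C \<sigma> :: real)"
      by (intro sum.cong refl) (simp add: indicator_def)
    also have "\<dots> = real (card (Sym n \<inter> C))"
      by (simp add: indicator_def sum.If_cases)
    finally show ?thesis using that by (simp add: Int_absorb1)
  qed
  have ff: "(\<Sum>\<sigma>\<in>Sym n. (f \<sigma>)\<^sup>2) = t * card A" "(\<Sum>\<sigma>\<in>Sym n. (g \<sigma>)\<^sup>2) = card B / t"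
    unfolding f_def g_def power_mult_distrib sum_distrib_left[symmetric] card[OF AB(1)] card[OF AB(2)]
    using s by (simp_all add: power2_eq_square)
  have fg: "f \<sigma> * g \<sigma> \<ge> 0" for \<sigma> using s by (simp add: f_def g_def)
  have "(\<Sum>\<sigma>\<in>Sym n. (f \<sigma> - g \<sigma>)\<^sup>2) \<le> (\<Sum>\<sigma>\<in>Sym n. (f \<sigma>)\<^sup>2 + (g \<sigma>)\<^sup>2)"
    using fg by (intro sum_mono) (simp add: power2_diff)
  also have "\<dots> = E" by (simp add: sum.distrib ff E_def)
  finally have "K * (\<Sum>\<sigma>\<in>Sym n. (f \<sigma> - g \<sigma>)\<^sup>2) \<le> K * E"
    using K by (intro mult_left_mono) auto
  then have "4 * cell_form n f g \<ge> - (K * E)"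
    using cell_form_polarization[of n f g] cell_form_nonneg[of n "\<lambda>\<sigma>. f \<sigma> + g \<sigma>"]
      cell_form_upper[OF n, of "\<lambda>\<sigma>. f \<sigma> - g \<sigma>", folded K_def] n by linarith
  then have "- (K * E / 4) \<le> cell_form n f g" by simp
  then show "cell_form n (indicator A) (indicator B)
      \<ge> - (fact n / (4 * (real n - 1)) * (t * card A + card B / t))"
    unfolding eq K_def E_def by (simp add: mult.commute)
  have "(\<Sum>\<sigma>\<in>Sym n. (f \<sigma> + g \<sigma>)\<^sup>2) \<le> (\<Sum>\<sigma>\<in>Sym n. 2 * ((f \<sigma>)\<^sup>2 + (g \<sigma>)\<^sup>2))"
  proof (intro sum_mono)
    fix \<sigma> show "(f \<sigma> + g \<sigma>)\<^sup>2 \<le> 2 * ((f \<sigma>)\<^sup>2 + (g \<sigma>)\<^sup>2)"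
      using sum_squares_bound[of "f \<sigma>" "g \<sigma>"] by (simp add: power2_sum)
  qed
  also have "\<dots> = 2 * E" by (simp add: sum.distrib ff E_def flip: sum_distrib_left)
  finally have "K * (\<Sum>\<sigma>\<in>Sym n. (f \<sigma> + g \<sigma>)\<^sup>2) \<le> K * (2 * E)"
    using K by (intro mult_left_mono) auto
  then have "4 * cell_form n f g \<le> K * (2 * E)"
    using cell_form_polarization[of n f g] cell_form_nonneg[of n "\<lambda>\<sigma>. f \<sigma> - g \<sigma>"]
      cell_form_upper[OF n, of "\<lambda>\<sigma>. f \<sigma> + g \<sigma>", folded K_def] n by linarith
  then have "cell_form n f g \<le> K * E / 2" by (simp add: mult.commute)
  then show "cell_form n (indicator A) (indicator B)
      \<le> fact n / (2 * (real n - 1)) * (t * card A + card B / t)"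
    unfolding eq K_def E_def by (simp add: mult.commute)
qed

section \<open>Agreements in cross-intersecting families\<close>

lemma perm_intersect_iff_agree: "perm_intersect n \<sigma> \<tau> \<longleftrightarrow> agree n \<sigma> \<tau> \<ge> 1"
proof -
  have "agree n \<sigma> \<tau> \<ge> 1 \<longleftrightarrow> {k \<in> {1..n}. \<sigma> k = \<tau> k} \<noteq> {}"
    unfolding agree_def by (simp add: Suc_le_eq card_gt_0_iff One_nat_def)
  then show ?thesis by (auto simp: perm_intersect_def)
qed

lemma agree_le: "agree n \<sigma> \<tau> \<le> n"
  unfolding agree_def by (rule order.trans[OF card_mono[of "{1..n}"]]) auto

lemma finite_subset_Sym: "A \<subseteq> Sym n \<Longrightarrow> finite A"
  by (rule finite_subset[OF _ finite_Sym])

text \<open>Union bound over the r-sets of common positions: binomial(n, r) (n-r)! = n!/r!. Large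
  agreement numbers become negligible once r! beats a power of n.\<close>

lemma card_agree_ge:
  assumes "\<sigma> \<in> Sym n" "r \<le> n"
  shows "card {\<tau> \<in> Sym n. agree n \<sigma> \<tau> \<ge> r} * fact r \<le> fact n"
proof -
  let ?R = "{R. R \<subseteq> {1..n} \<and> card R = r}"
  let ?T = "\<lambda>R. {\<tau>. \<tau> permutes {1..n} \<and> (\<forall>x\<in>R. \<tau> x = \<sigma> x)}"
  have fin: "finite ?R" by simp
  have "{\<tau> \<in> Sym n. agree n \<sigma> \<tau> \<ge> r} \<subseteq> (\<Union>R\<in>?R. ?T R)"
  proof
    fix \<tau> assume t: "\<tau> \<in> {\<tau> \<in> Sym n. agree n \<sigma> \<tau> \<ge> r}"
    then obtain R where "R \<subseteq> {k \<in> {1..n}. \<sigma> k = \<tau> k}" "card R = r"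
      unfolding agree_def by (metis (mono_tags, lifting) mem_Collect_eq obtain_subset_with_card_n)
    then show "\<tau> \<in> (\<Union>R\<in>?R. ?T R)" using t by (auto simp: Sym_def intro!: exI[of _ R])
  qed
  moreover have fT: "finite (?T R)" for R
    using finite_permutations[of "{1..n}"] by (auto intro: finite_subset[rotated])
  ultimately have "card {\<tau> \<in> Sym n. agree n \<sigma> \<tau> \<ge> r} \<le> card (\<Union>R\<in>?R. ?T R)"
    using fin by (intro card_mono finite_UN_I) auto
  also have "\<dots> \<le> (\<Sum>R\<in>?R. card (?T R))" using fin by (rule card_UN_le)
  also have "\<dots> = (\<Sum>R\<in>?R. fact (n - r))"
    using assms by (intro sum.cong refl) (simp add: Sym_def card_permutes_agree)
  also have "\<dots> = (n choose r) * fact (n - r)" by (simp add: n_subsets)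
  finally have "card {\<tau> \<in> Sym n. agree n \<sigma> \<tau> \<ge> r} * fact r \<le> (n choose r) * fact (n - r) * fact r"
    by (rule mult_le_mono1)
  also have "\<dots> = fact n" using binomial_fact_lemma[OF assms(2)] by (simp add: mult_ac)
  finally show ?thesis .
qed

text \<open>An agreement of \<open>\<sigma>\<close> and \<open>\<tau>\<close> is a coset that
  contains both. The constant weight 1 yields the first moment of the agreement number, and the
  agreement number itself as weight yields the second moment, slice by slice.\<close>

lemma sum_agree_weighted:
  fixes w :: "(nat \<Rightarrow> nat) \<Rightarrow> (nat \<Rightarrow> nat) \<Rightarrow> real"
  assumes "A \<subseteq> Sym n" "B \<subseteq> Sym n"
  shows "(\<Sum>\<sigma>\<in>A. \<Sum>\<tau>\<in>B. real (agree n \<sigma> \<tau>) * w \<sigma> \<tau>)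
    = (\<Sum>i\<in>{1..n}. \<Sum>j\<in>{1..n}. \<Sum>\<sigma>\<in>A \<inter> coset1 n i j. \<Sum>\<tau>\<in>B \<inter> coset1 n i j. w \<sigma> \<tau>)"
proof -
  have fin: "finite A" "finite B" using assms finite_subset_Sym by auto
  have "real (agree n \<sigma> \<tau>) * w \<sigma> \<tau>
      = (\<Sum>i\<in>{1..n}. \<Sum>j\<in>{1..n}. if \<sigma> i = j \<and> \<tau> i = j then w \<sigma> \<tau> else 0)"
    if "\<sigma> \<in> A" for \<sigma> \<tau>
  proof -
    have "(\<Sum>j\<in>{1..n}. if \<sigma> i = j \<and> \<tau> i = j then w \<sigma> \<tau> else 0)
        = (if \<sigma> i = \<tau> i then w \<sigma> \<tau> else 0)" if "i \<in> {1..n}" for i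
    proof -
      have "(\<Sum>j\<in>{1..n}. if \<sigma> i = j \<and> \<tau> i = j then w \<sigma> \<tau> else 0)
        = (\<Sum>j\<in>{1..n}. if \<sigma> i = j then (if \<sigma> i = \<tau> i then w \<sigma> \<tau> else 0) else 0)"
        by (intro sum.cong) auto
      then show ?thesis
        using Sym_in_image[of \<sigma> n i] that \<open>\<sigma> \<in> A\<close> assms by (auto simp: sum.delta')
    qed
    then have "(\<Sum>i\<in>{1..n}. \<Sum>j\<in>{1..n}. if \<sigma> i = j \<and> \<tau> i = j then w \<sigma> \<tau> else 0)
        = (\<Sum>i\<in>{1..n}. if \<sigma> i = \<tau> i then w \<sigma> \<tau> else 0)"
      by (intro sum.cong refl) auto
    also have "\<dots> = real (agree n \<sigma> \<tau>) * w \<sigma> \<tau>"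
      by (simp add: agree_def flip: sum.inter_filter)
    finally show ?thesis ..
  qed
  then have "(\<Sum>\<sigma>\<in>A. \<Sum>\<tau>\<in>B. real (agree n \<sigma> \<tau>) * w \<sigma> \<tau>)
    = (\<Sum>\<sigma>\<in>A. \<Sum>\<tau>\<in>B. \<Sum>i\<in>{1..n}. \<Sum>j\<in>{1..n}. if \<sigma> i = j \<and> \<tau> i = j then w \<sigma> \<tau> else 0)"
    by (intro sum.cong refl) auto
  also have "\<dots> = (\<Sum>\<sigma>\<in>A. \<Sum>i\<in>{1..n}. \<Sum>\<tau>\<in>B. \<Sum>j\<in>{1..n}. if \<sigma> i = j \<and> \<tau> i = j then w \<sigma> \<tau> else 0)"
    by (intro sum.cong refl sum.swap)
  also have "\<dots> = (\<Sum>\<sigma>\<in>A. \<Sum>i\<in>{1..n}. \<Sum>j\<in>{1..n}. \<Sum>\<tau>\<in>B. if \<sigma> i = j \<and> \<tau> i = j then w \<sigma> \<tau> else 0)"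
    by (intro sum.cong refl sum.swap)
  also have "\<dots> = (\<Sum>i\<in>{1..n}. \<Sum>\<sigma>\<in>A. \<Sum>j\<in>{1..n}. \<Sum>\<tau>\<in>B. if \<sigma> i = j \<and> \<tau> i = j then w \<sigma> \<tau> else 0)"
    by (rule sum.swap)
  also have "\<dots> = (\<Sum>i\<in>{1..n}. \<Sum>j\<in>{1..n}. \<Sum>\<sigma>\<in>A. \<Sum>\<tau>\<in>B. if \<sigma> i = j \<and> \<tau> i = j then w \<sigma> \<tau> else 0)"
    by (intro sum.cong refl sum.swap)
  also have "\<dots> = (\<Sum>i\<in>{1..n}. \<Sum>j\<in>{1..n}. \<Sum>\<sigma>\<in>A \<inter> coset1 n i j. \<Sum>\<tau>\<in>B \<inter> coset1 n i j. w \<sigma> \<tau>)"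
  proof (rule sum.cong[OF refl], rule sum.cong[OF refl])
    fix i j
    have *: "A \<inter> coset1 n i j = {\<sigma> \<in> A. \<sigma> i = j}" "B \<inter> coset1 n i j = {\<sigma> \<in> B. \<sigma> i = j}"
      using assms by (auto simp: coset1_def)
    show "(\<Sum>\<sigma>\<in>A. \<Sum>\<tau>\<in>B. if \<sigma> i = j \<and> \<tau> i = j then w \<sigma> \<tau> else 0)
      = (\<Sum>\<sigma>\<in>A \<inter> coset1 n i j. \<Sum>\<tau>\<in>B \<inter> coset1 n i j. w \<sigma> \<tau>)"
      unfolding * using fin by (simp add: sum.inter_filter) (auto intro!: sum.cong)
  qed
  finally show ?thesis .
qed

lemma cell_indicator:
  assumes "A \<subseteq> Sym n"
  shows "cell n (indicator A) i j = real (card (A \<inter> coset1 n i j))"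
  unfolding cell_def by (simp add: indicator_def sum.If_cases Int_commute)

lemma sum_indicator_Sym: "A \<subseteq> Sym n \<Longrightarrow> (\<Sum>\<sigma>\<in>Sym n. indicator A \<sigma>) = real (card A)"
  by (simp add: indicator_def sum.If_cases Int_absorb1)

lemma sum_agree:
  assumes "A \<subseteq> Sym n" "B \<subseteq> Sym n"
  shows "(\<Sum>\<sigma>\<in>A. \<Sum>\<tau>\<in>B. real (agree n \<sigma> \<tau>))
    = cell_form n (indicator A) (indicator B) + real (card A) * real (card B)"
proof -
  have "(\<Sum>\<sigma>\<in>A. \<Sum>\<tau>\<in>B. real (agree n \<sigma> \<tau>))
     = (\<Sum>i\<in>{1..n}. \<Sum>j\<in>{1..n}. cell n (indicator A) i j * cell n (indicator B) i j)"
    using sum_agree_weighted[OF assms, of "\<lambda>_ _. 1"] by (simp add: cell_indicator assms)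
  then show ?thesis unfolding cell_form_def using assms by (simp add: sum_indicator_Sym)
qed

text \<open>Identifies the coset \<open>\<sigma> i = j\<close> with \<open>Sym (n - 1)\<close>; the agreement at \<open>i\<close> is lost.\<close>

definition slice_map :: "nat \<Rightarrow> nat \<Rightarrow> nat \<Rightarrow> (nat \<Rightarrow> nat) \<Rightarrow> (nat \<Rightarrow> nat)" where
  "slice_map n i j \<sigma> = transpose j n \<circ> \<sigma> \<circ> transpose i n"

lemma slice_map_Sym:
  assumes "i \<in> {1..n}" "j \<in> {1..n}" "\<sigma> \<in> coset1 n i j"
  shows "slice_map n i j \<sigma> \<in> Sym (n - 1)"
proof -
  have n: "n \<in> {1..n}" using assms by auto
  have "slice_map n i j \<sigma> permutes {1..n}" unfolding slice_map_def
    by (intro permutes_compose permutes_swap_id) (use assms n in \<open>auto simp: coset1_def Sym_def\<close>)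
  moreover have "slice_map n i j \<sigma> n = n" using assms by (simp add: slice_map_def coset1_def)
  moreover have "{1..n} - {1..n - 1} = {n}" using n by auto
  ultimately have "slice_map n i j \<sigma> permutes {1..n - 1}"
    by (metis permutes_superset singletonD)
  then show ?thesis by (simp add: Sym_def)
qed

lemma inj_slice_map: "inj (slice_map n i j)"
proof (rule injI)
  fix \<sigma> \<tau> assume *: "slice_map n i j \<sigma> = slice_map n i j \<tau>"
  have "transpose j n \<circ> slice_map n i j \<sigma> \<circ> transpose i n = \<sigma>" for \<sigma>
    by (simp add: slice_map_def fun_eq_iff)
  then show "\<sigma> = \<tau>" using * by metis
qed

lemma agree_slice_map:
  assumes "i \<in> {1..n}" "\<sigma> \<in> coset1 n i j" "\<tau> \<in> coset1 n i j"
  shows "agree n \<sigma> \<tau> = Suc (agree (n - 1) (slice_map n i j \<sigma>) (slice_map n i j \<tau>))"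
proof -
  let ?s = "slice_map n i j \<sigma>" and ?t = "slice_map n i j \<tau>"
  have eq: "?s k = ?t k \<longleftrightarrow> \<sigma> (transpose i n k) = \<tau> (transpose i n k)" for k
    unfolding slice_map_def o_apply by (metis transpose_involutory)
  have n: "n \<in> {1..n}" using assms by auto
  have "{k \<in> {1..n}. \<sigma> k = \<tau> k} = transpose i n ` {k \<in> {1..n}. ?s k = ?t k}"
  proof (intro equalityI subsetI)
    fix k assume k: "k \<in> {k \<in> {1..n}. \<sigma> k = \<tau> k}"
    have "transpose i n k \<in> {k \<in> {1..n}. ?s k = ?t k}"
      using k assms n by (auto simp: eq transpose_def)
    then show "k \<in> transpose i n ` {k \<in> {1..n}. ?s k = ?t k}"
      by (metis image_eqI transpose_involutory)
  qed (use assms n eq in \<open>auto simp: transpose_def\<close>)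
  then have "agree n \<sigma> \<tau> = card {k \<in> {1..n}. ?s k = ?t k}"
    unfolding agree_def by (simp add: card_image)
  also have "{k \<in> {1..n}. ?s k = ?t k} = insert n {k \<in> {1..n - 1}. ?s k = ?t k}"
    using n assms by (auto simp: eq coset1_def)
  also have "card \<dots> = Suc (card {k \<in> {1..n - 1}. ?s k = ?t k})"
    using n by (intro card_insert_disjoint) auto
  finally show ?thesis by (simp only: agree_def)
qed

text \<open>Every pair in the slice agrees at \<open>i\<close>, which contributes
  \<open>a * b\<close>. The agreements elsewhere are those of a pair in \<open>Sym (n - 1)\<close>
  and contribute another \<open>a * b\<close> plus a value of the form, which is bounded below by
  the spectral estimate.\<close>

lemma sum_agree_slice_ge:
  fixes t :: real
  assumes n: "n \<ge> 3" and AB: "A \<subseteq> Sym n" "B \<subseteq> Sym n" and t: "t > 0"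
    and ij: "i \<in> {1..n}" "j \<in> {1..n}"
  defines "a \<equiv> real (card (A \<inter> coset1 n i j))" and "b \<equiv> real (card (B \<inter> coset1 n i j))"
  shows "(\<Sum>\<sigma>\<in>A \<inter> coset1 n i j. \<Sum>\<tau>\<in>B \<inter> coset1 n i j. real (agree n \<sigma> \<tau>))
    \<ge> 2 * a * b - fact (n - 1) / (4 * (real n - 2)) * (t * a + b / t)"
proof -
  let ?f = "slice_map n i j" and ?A = "A \<inter> coset1 n i j" and ?B = "B \<inter> coset1 n i j"
  have inj: "inj_on ?f X" for X using inj_slice_map by (rule inj_on_subset) auto
  have sub: "?f ` ?A \<subseteq> Sym (n - 1)" "?f ` ?B \<subseteq> Sym (n - 1)"
    using slice_map_Sym ij by auto
  have card: "card (?f ` ?A) = card ?A" "card (?f ` ?B) = card ?B"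
    using inj by (auto intro: card_image)
  have "(\<Sum>\<sigma>\<in>?A. \<Sum>\<tau>\<in>?B. real (agree n \<sigma> \<tau>))
     = (\<Sum>\<sigma>\<in>?A. \<Sum>\<tau>\<in>?B. 1 + real (agree (n - 1) (?f \<sigma>) (?f \<tau>)))"
    using ij by (intro sum.cong refl) (auto simp: agree_slice_map)
  also have "\<dots> = a * b + (\<Sum>\<sigma>\<in>?A. \<Sum>\<tau>\<in>?B. real (agree (n - 1) (?f \<sigma>) (?f \<tau>)))"
    by (simp add: sum.distrib a_def b_def)
  also have "(\<Sum>\<sigma>\<in>?A. \<Sum>\<tau>\<in>?B. real (agree (n - 1) (?f \<sigma>) (?f \<tau>)))
     = (\<Sum>\<sigma>\<in>?f ` ?A. \<Sum>\<tau>\<in>?f ` ?B. real (agree (n - 1) \<sigma> \<tau>))"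
    by (simp add: sum.reindex[OF inj])
  also have "\<dots> = cell_form (n - 1) (indicator (?f ` ?A)) (indicator (?f ` ?B)) + a * b"
    using sum_agree[OF sub] by (simp add: card a_def b_def)
  finally have "(\<Sum>\<sigma>\<in>?A. \<Sum>\<tau>\<in>?B. real (agree n \<sigma> \<tau>))
     = 2 * a * b + cell_form (n - 1) (indicator (?f ` ?A)) (indicator (?f ` ?B))" by simp
  moreover have "real (n - 1) - 1 = real n - 2" using n by simp
  then have "cell_form (n - 1) (indicator (?f ` ?A)) (indicator (?f ` ?B))
     \<ge> - (fact (n - 1) / (4 * (real n - 2)) * (t * a + b / t))"
    using cell_form_indicator_bounds(1)[OF _ sub t] n by (simp add: card a_def b_def)
  ultimately show ?thesis by simp
qed

text \<open>Expand (N - 1)(M - N) = (M + 1) N - N^2 - M and sum. The slices bound the sum of N^2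
  below by 2 P minus a loss, so the coefficient of \<open>P\<close> drops from M + 1 to M - 1. It is
  now smaller by one than the coefficient M of \<open>a * b\<close>, and this difference is the
  gain.\<close>

lemma cross_intersecting_agree_moments:
  fixes t :: real
  assumes n: "n \<ge> 3" and AB: "A \<subseteq> Sym n" "B \<subseteq> Sym n" and t: "t > 0"
    and cross: "cross_intersecting n A B" and M: "M \<le> n"
  defines "a \<equiv> real (card A)" and "b \<equiv> real (card B)"
  defines "P \<equiv> cell_form n (indicator A) (indicator B) + a * b"
  shows "real M * a * b \<le> (real M - 1) * P
    + fact n / (4 * (real n - 2)) * (t * a + b / t) + a * (real n)\<^sup>2 * fact n / fact M"
proof -
  have fin: "finite A" "finite B" using AB finite_subset_Sym by auto
  let ?N = "\<lambda>\<sigma> \<tau>. real (agree n \<sigma> \<tau>)"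
  have P: "(\<Sum>\<sigma>\<in>A. \<Sum>\<tau>\<in>B. ?N \<sigma> \<tau>) = P"
    unfolding P_def a_def b_def using AB by (rule sum_agree)
  have cells: "(\<Sum>i\<in>{1..n}. \<Sum>j\<in>{1..n}. real (card (A \<inter> coset1 n i j)) * real (card (B \<inter> coset1 n i j))) = P"
    using sum_agree_weighted[OF AB, of "\<lambda>_ _. 1"] P by simp
  have rows: "(\<Sum>i\<in>{1..n}. \<Sum>j\<in>{1..n}. real (card (C \<inter> coset1 n i j))) = real n * real (card C)"
    if "C \<subseteq> Sym n" for C
    using that by (simp add: sum_cell_row sum_indicator_Sym flip: cell_indicator)
  define c where "c = fact (n - 1) / (4 * (real n - 2))"
  have "(\<Sum>\<sigma>\<in>A. \<Sum>\<tau>\<in>B. ?N \<sigma> \<tau> * ?N \<sigma> \<tau>)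
    = (\<Sum>i\<in>{1..n}. \<Sum>j\<in>{1..n}. \<Sum>\<sigma>\<in>A \<inter> coset1 n i j. \<Sum>\<tau>\<in>B \<inter> coset1 n i j. ?N \<sigma> \<tau>)"
    using AB by (rule sum_agree_weighted)
  moreover have "\<dots> \<ge> (\<Sum>i\<in>{1..n}. \<Sum>j\<in>{1..n}.
      2 * (real (card (A \<inter> coset1 n i j)) * real (card (B \<inter> coset1 n i j)))
      - (c * t * real (card (A \<inter> coset1 n i j)) + c / t * real (card (B \<inter> coset1 n i j))))"
  proof (intro sum_mono)
    fix i j assume "i \<in> {1..n}" "j \<in> {1..n}"
    from sum_agree_slice_ge[OF n AB t this]
    show "2 * (real (card (A \<inter> coset1 n i j)) * real (card (B \<inter> coset1 n i j)))
      - (c * t * real (card (A \<inter> coset1 n i j)) + c / t * real (card (B \<inter> coset1 n i j)))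
      \<le> (\<Sum>\<sigma>\<in>A \<inter> coset1 n i j. \<Sum>\<tau>\<in>B \<inter> coset1 n i j. ?N \<sigma> \<tau>)"
      unfolding c_def[symmetric] by (simp add: algebra_simps)
  qed
  moreover have "(\<Sum>i\<in>{1..n}. \<Sum>j\<in>{1..n}.
      2 * (real (card (A \<inter> coset1 n i j)) * real (card (B \<inter> coset1 n i j)))
      - (c * t * real (card (A \<inter> coset1 n i j)) + c / t * real (card (B \<inter> coset1 n i j))))
      = 2 * P - (c * t * (real n * a) + c / t * (real n * b))"
    unfolding sum_subtractf sum.distrib sum_distrib_left[symmetric] cells rows[OF AB(1)] rows[OF AB(2)]
      a_def b_def ..
  moreover have "\<dots> = 2 * P - fact n / (4 * (real n - 2)) * (t * a + b / t)"
  proof -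
    have "fact n = real n * fact (n - 1)" using n by (subst fact_reduce) auto
    then have c: "fact n / (4 * (real n - 2)) = real n * c" by (simp add: c_def)
    show ?thesis unfolding c by (simp add: algebra_simps)
  qed
  ultimately have sq: "(\<Sum>\<sigma>\<in>A. \<Sum>\<tau>\<in>B. ?N \<sigma> \<tau> * ?N \<sigma> \<tau>)
      \<ge> 2 * P - fact n / (4 * (real n - 2)) * (t * a + b / t)" by linarith
  have tail: "(\<Sum>\<tau>\<in>B. (real M + 1) * ?N \<sigma> \<tau> - ?N \<sigma> \<tau> * ?N \<sigma> \<tau> - real M)
      \<ge> - ((real n)\<^sup>2 * fact n / fact M)" if s: "\<sigma> \<in> A" for \<sigma>
  proof -
    \<comment> \<open>With fewer than \<open>M\<close> agreements the summand is nonnegative,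
      because cross-intersection gives N \<ge> 1. Each of the remaining pairs costs at most n^2, and
      for fixed \<open>\<sigma>\<close> there are at most n!/M! of them.\<close>
    let ?T = "{\<tau> \<in> B. agree n \<sigma> \<tau> \<ge> M}"
    have "(\<Sum>\<tau>\<in>B. (real M + 1) * ?N \<sigma> \<tau> - ?N \<sigma> \<tau> * ?N \<sigma> \<tau> - real M)
       \<ge> (\<Sum>\<tau>\<in>B. if agree n \<sigma> \<tau> \<ge> M then - (real n)\<^sup>2 else 0)"
    proof (intro sum_mono)
      fix \<tau> assume "\<tau> \<in> B"
      then have 1: "?N \<sigma> \<tau> \<ge> 1"
        using cross s by (auto simp: cross_intersecting_def perm_intersect_iff_agree)
      have 2: "?N \<sigma> \<tau> \<le> real n" using agree_le by simp
      have e: "(real M + 1) * ?N \<sigma> \<tau> - ?N \<sigma> \<tau> * ?N \<sigma> \<tau> - real M = (?N \<sigma> \<tau> - 1) * (real M - ?N \<sigma> \<tau>)"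
        by (simp add: algebra_simps)
      show "(if agree n \<sigma> \<tau> \<ge> M then - (real n)\<^sup>2 else 0)
        \<le> (real M + 1) * ?N \<sigma> \<tau> - ?N \<sigma> \<tau> * ?N \<sigma> \<tau> - real M"
      proof (cases "agree n \<sigma> \<tau> \<ge> M")
        case True
        have "(?N \<sigma> \<tau> - 1) * (?N \<sigma> \<tau> - real M) \<le> real n * real n"
          using 1 2 True by (intro mult_mono) auto
        then show ?thesis unfolding e using True by (simp add: power2_eq_square algebra_simps)
      next
        case False
        then show ?thesis unfolding e using 1 by simp
      qed
    qed
    moreover have "(\<Sum>\<tau>\<in>B. if agree n \<sigma> \<tau> \<ge> M then - (real n)\<^sup>2 else 0) = - (real n)\<^sup>2 * card ?T"
      using fin by (simp flip: sum.inter_filter)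
    moreover have "- (real n)\<^sup>2 * card ?T \<ge> - ((real n)\<^sup>2 * fact n / fact M)"
    proof -
      have "card ?T \<le> card {\<tau> \<in> Sym n. agree n \<sigma> \<tau> \<ge> M}"
        using AB by (intro card_mono) auto
      then have "card ?T * fact M \<le> fact n"
        using card_agree_ge[of \<sigma> n M] s AB M by (meson subsetD mult_le_mono1 order_trans)
      then have "real (card ?T * fact M) \<le> real (fact n)" by (simp only: of_nat_le_iff)
      then have "real (card ?T) \<le> fact n / fact M" by (simp add: pos_le_divide_eq)
      then show ?thesis
        using mult_left_mono[of "real (card ?T)" "fact n / fact M" "(real n)\<^sup>2"] by simp
    qed
    ultimately show ?thesis by linarith
  qed
  have "- (a * ((real n)\<^sup>2 * fact n / fact M))
     \<le> (\<Sum>\<sigma>\<in>A. \<Sum>\<tau>\<in>B. (real M + 1) * ?N \<sigma> \<tau> - ?N \<sigma> \<tau> * ?N \<sigma> \<tau> - real M)"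
    using sum_mono[of A "\<lambda>_. - ((real n)\<^sup>2 * fact n / fact M)", OF tail] by (simp add: a_def)
  also have "\<dots> = (real M + 1) * P - (\<Sum>\<sigma>\<in>A. \<Sum>\<tau>\<in>B. ?N \<sigma> \<tau> * ?N \<sigma> \<tau>) - real M * a * b"
    unfolding sum_subtractf sum_distrib_left[symmetric] P by (simp add: a_def b_def)
  finally show ?thesis using sq by (simp add: algebra_simps)
qed

text \<open>With t = sqrt(b/a) the two summands of t a + b/t are equal, which is the minimum by
  AM-GM.\<close>

lemma balanced_weight:
  fixes a b :: real
  assumes "a > 0" "b > 0"
  shows "sqrt (b / a) * a + b / sqrt (b / a) = 2 * sqrt (a * b)"
proof -
  define p q where "p = sqrt a" and "q = sqrt b"
  have pq: "p > 0" "q > 0" "a = p * p" "b = q * q" using assms by (auto simp: p_def q_def)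
  have "sqrt (b / a) = q / p" "sqrt (a * b) = p * q"
    by (simp_all add: p_def q_def real_sqrt_divide real_sqrt_mult)
  then show ?thesis using pq by (simp add: field_simps)
qed

text \<open>Substituting P = Q + ab cancels all but one copy of ab. If sqrt(ab) is clearly above
  (n-1)!/2, the middle term cannot account for all of ab, and \<open>Q\<close> has to be positive
  and of order at least ab/M. The upper bound on \<open>Q\<close> comes from the same choice of the
  weight.\<close>

lemma cross_intersecting_correlation:
  assumes n: "n \<ge> 3" and AB: "A \<subseteq> Sym n" "B \<subseteq> Sym n" "A \<noteq> {}" "B \<noteq> {}"
    and cross: "cross_intersecting n A B" and M: "M \<le> n"
  defines "a \<equiv> real (card A)" and "b \<equiv> real (card B)"
  defines "Q \<equiv> cell_form n (indicator A) (indicator B)"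
  shows "a * b \<le> (real M - 1) * Q
    + fact n / (2 * (real n - 2)) * sqrt (a * b) + a * (real n)\<^sup>2 * fact n / fact M"
    and "Q \<le> fact n / (real n - 1) * sqrt (a * b)"
proof -
  have fin: "finite A" "finite B" using AB finite_subset_Sym by auto
  have ab: "a > 0" "b > 0" using AB fin by (auto simp: a_def b_def card_gt_0_iff)
  have t: "sqrt (b / a) > 0" using ab by simp
  have e: "fact n / (4 * (real n - 2)) * (sqrt (b / a) * a + b / sqrt (b / a))
      = fact n / (2 * (real n - 2)) * sqrt (a * b)"
    unfolding balanced_weight[OF ab] by (simp add: divide_simps)
  have "real M * a * b \<le> (real M - 1) * (Q + a * b)
    + fact n / (4 * (real n - 2)) * (sqrt (b / a) * a + b / sqrt (b / a)) + a * (real n)\<^sup>2 * fact n / fact M"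
    using cross_intersecting_agree_moments[OF n AB(1,2) t cross M] unfolding a_def b_def Q_def .
  then show "a * b \<le> (real M - 1) * Q
    + fact n / (2 * (real n - 2)) * sqrt (a * b) + a * (real n)\<^sup>2 * fact n / fact M"
    unfolding e by (simp add: algebra_simps)
  have "Q \<le> fact n / (2 * (real n - 1)) * (sqrt (b / a) * a + b / sqrt (b / a))"
    using cell_form_indicator_bounds(2)[OF _ AB(1,2) t] n unfolding a_def b_def Q_def by simp
  also have "\<dots> = fact n / (real n - 1) * sqrt (a * b)"
    unfolding balanced_weight[OF ab] by (simp add: divide_simps)
  finally show "Q \<le> fact n / (real n - 1) * sqrt (a * b)" .
qed

text \<open>Inserting the upper bound for Q into the lower one gives a quadratic inequality for w =
  sqrt(ab)/(n-1)!, namely w^2 \<le> (M + 1) w + 1. The loss of (M + 2)^2 is affordable because it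
  will compete with a factor of order n.\<close>

lemma cross_intersecting_weak_bound:
  assumes n: "n \<ge> 4" and AB: "A \<subseteq> Sym n" "B \<subseteq> Sym n"
    and cross: "cross_intersecting n A B" and M: "1 \<le> M" "M \<le> n" "n ^ 4 \<le> fact M"
  shows "real (card A) * real (card B) \<le> (real M + 2)\<^sup>2 * (fact (n - 1))\<^sup>2"
proof (cases "A = {} \<or> B = {}")
  case False
  define F :: real where "F = fact (n - 1)"
  have F: "F > 0" by (simp add: F_def)
  have nF: "fact n = real n * F" unfolding F_def using n by (subst fact_reduce) auto
  define a b where "a = real (card A)" and "b = real (card B)"
  define Q where "Q = cell_form n (indicator A) (indicator B)"
  define w where "w = sqrt (a * b) / F"
  have ab: "a * b = w\<^sup>2 * F\<^sup>2" and s: "sqrt (a * b) = w * F" and w: "w \<ge> 0"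
    using F by (simp_all add: w_def a_def b_def power_divide)
  have "card A \<le> card (Sym n)" using AB by (intro card_mono) auto
  then have "a \<le> real (fact n)" unfolding a_def card_Sym by (rule of_nat_mono)
  then have a: "a \<le> real n * F" using nF by simp
  have "real (n ^ 4) \<le> real (fact M)" using M(3) by (rule of_nat_mono)
  then have M4: "real n ^ 4 \<le> fact M" by simp
  have n4: "real n \<ge> 4" using n by simp
  \<comment> \<open>The exponent 4 in the assumption on \<open>fact M\<close>: one factor n from the
    bound on \<open>a\<close>, two from the square, one from \<open>fact n\<close>.\<close>
  have "a * (real n)\<^sup>2 * fact n / fact M \<le> (real n * F) * (real n)\<^sup>2 * (real n * F) / (real n ^ 4)"
    unfolding nF using a F n4 M4 by (intro frac_le mult_right_mono) auto
  also have "\<dots> = F\<^sup>2" using n4 by (simp add: power2_eq_square power4_eq_xxxx)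
  finally have err: "a * (real n)\<^sup>2 * fact n / fact M \<le> F\<^sup>2" .
  have Q: "Q \<le> real n / (real n - 1) * w * F\<^sup>2"
    using cross_intersecting_correlation(2)[OF _ AB _ _ cross M(2)] False n
    unfolding a_def[symmetric] b_def[symmetric] Q_def[symmetric] s nF by (simp add: power2_eq_square algebra_simps)
  have "(real M - 1) * Q \<le> (real M - 1) * (real n / (real n - 1) * w * F\<^sup>2)"
    using Q M by (intro mult_left_mono) auto
  also have "\<dots> = ((real M - 1) * (real n / (real n - 1))) * (w * F\<^sup>2)" by simp
  also have "\<dots> \<le> real M * (w * F\<^sup>2)"
  proof (rule mult_right_mono)
    have "(real M - 1) * real n \<le> real M * (real n - 1)" using M by (simp add: algebra_simps)
    then show "(real M - 1) * (real n / (real n - 1)) \<le> real M"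
      using n4 by (simp add: divide_le_eq)
  qed (use w in auto)
  finally have 1: "(real M - 1) * Q \<le> real M * (w * F\<^sup>2)" .
  have "fact n / (2 * (real n - 2)) * sqrt (a * b) = (real n / (2 * (real n - 2))) * (w * F\<^sup>2)"
    unfolding s nF by (simp add: power2_eq_square)
  also have "\<dots> \<le> 1 * (w * F\<^sup>2)"
    using w n4 by (intro mult_right_mono) (auto simp: divide_le_eq)
  finally have 2: "fact n / (2 * (real n - 2)) * sqrt (a * b) \<le> w * F\<^sup>2" by simp
  have "a * b \<le> (real M - 1) * Q + fact n / (2 * (real n - 2)) * sqrt (a * b)
      + a * (real n)\<^sup>2 * fact n / fact M"
    using cross_intersecting_correlation(1)[OF _ AB _ _ cross M(2)] False n
    unfolding a_def[symmetric] b_def[symmetric] Q_def[symmetric] by simp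
  also have "\<dots> \<le> real M * (w * F\<^sup>2) + w * F\<^sup>2 + F\<^sup>2" using 1 2 err by linarith
  also have "\<dots> = (real M * w + w + 1) * F\<^sup>2" by (simp add: algebra_simps)
  finally have "w\<^sup>2 * F\<^sup>2 \<le> (real M * w + w + 1) * F\<^sup>2" unfolding ab .
  then have w2: "w * w \<le> real M * w + w + 1" using F by (simp add: power2_eq_square)
  have "w \<le> real M + 2"
  proof (rule ccontr)
    assume "\<not> w \<le> real M + 2"
    then have "w > real M + 2" by simp
    then have "(real M + 2) * w < w * w" "1 < w" by (auto intro!: mult_strict_right_mono)
    then show False using w2 by (simp add: algebra_simps)
  qed
  then have "w\<^sup>2 * F\<^sup>2 \<le> (real M + 2)\<^sup>2 * F\<^sup>2" using w by (intro mult_right_mono power_mono) auto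
  then have "a * b \<le> (real M + 2)\<^sup>2 * F\<^sup>2" by (simp only: ab)
  then show ?thesis unfolding a_def b_def F_def .
qed auto

section \<open>Heavy cells\<close>

lemma sum_Sym_compose_transpose:
  fixes g :: "(nat \<Rightarrow> nat) \<Rightarrow> real"
  assumes "k \<in> {1..n}" "l \<in> {1..n}"
  shows "(\<Sum>\<sigma>\<in>Sym n. g (\<sigma> \<circ> transpose k l)) = (\<Sum>\<sigma>\<in>Sym n. g \<sigma>)"
proof (rule sum.reindex_bij_witness[of _ "\<lambda>\<sigma>. \<sigma> \<circ> transpose k l" "\<lambda>\<sigma>. \<sigma> \<circ> transpose k l"])
  fix \<sigma> assume s: "\<sigma> \<in> Sym n"
  show "\<sigma> \<circ> transpose k l \<circ> transpose k l = \<sigma>" by (simp add: fun_eq_iff)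
  show "\<sigma> \<circ> transpose k l \<circ> transpose k l = \<sigma>" by (simp add: fun_eq_iff)
  show "\<sigma> \<circ> transpose k l \<in> Sym n" using s assms
    unfolding Sym_def mem_Collect_eq by (intro permutes_compose permutes_swap_id)
  show "\<sigma> \<circ> transpose k l \<in> Sym n" by fact
qed simp

text \<open>Bounded by the exchangeable pair consisting of a uniformly random permutation and its
  composition with a random transposition.\<close>

lemma fourth_moment_le:
  fixes u :: "nat \<Rightarrow> nat \<Rightarrow> real"
  assumes row: "\<And>i. i \<in> {1..n} \<Longrightarrow> (\<Sum>j\<in>{1..n}. u i j) = 0"
    and bnd: "\<And>i j. i \<in> {1..n} \<Longrightarrow> j \<in> {1..n} \<Longrightarrow> \<bar>u i j\<bar> \<le> \<delta>"
    and n: "n \<ge> 2"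
  defines "S \<equiv> \<Sum>i\<in>{1..n}. \<Sum>j\<in>{1..n}. (u i j)\<^sup>2"
  shows "(\<Sum>\<sigma>\<in>Sym n. (\<Sum>i\<in>{1..n}. u i (\<sigma> i)) ^ 4) \<le> 72 * fact (n - 1) * (3 * S\<^sup>2 / real n + \<delta>\<^sup>2 * S)"
proof -
  define h where "h = (\<lambda>\<sigma>. \<Sum>i\<in>{1..n}. u i (\<sigma> i))"
  define V where "V = (\<lambda>\<sigma>. \<Sum>i\<in>{1..n}. (u i (\<sigma> i))\<^sup>2)"
  define d where "d = (\<lambda>k l \<sigma>. h \<sigma> - h (\<sigma> \<circ> transpose k l))"
  have S0: "S \<ge> 0" unfolding S_def by (intro sum_nonneg) auto
  have V0: "V \<sigma> \<ge> 0" for \<sigma> unfolding V_def by (intro sum_nonneg) auto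
  have reindex: "(\<Sum>l\<in>{1..n}. g (\<sigma> l)) = (\<Sum>j\<in>{1..n}. g j)" if "\<sigma> \<in> Sym n" for \<sigma> and g :: "nat \<Rightarrow> real"
    using that by (intro sum.reindex_bij_betw permutes_imp_bij) (simp add: Sym_def)
  have d_eq: "d k l \<sigma> = u k (\<sigma> k) + u l (\<sigma> l) - u k (\<sigma> l) - u l (\<sigma> k)"
    if kl: "k \<in> {1..n}" "l \<in> {1..n}" for k l \<sigma>
  proof (cases "k = l")
    case False
    have "d k l \<sigma> = (\<Sum>i\<in>{1..n}. u i (\<sigma> i) - u i (\<sigma> (transpose k l i)))"
      by (simp add: d_def h_def sum_subtractf)
    also have "\<dots> = (\<Sum>i\<in>{k,l}. u i (\<sigma> i) - u i (\<sigma> (transpose k l i)))"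
      using kl by (intro sum.mono_neutral_right) (auto simp: transpose_def)
    finally show ?thesis using False by simp
  qed (simp add: d_def)
  \<comment> \<open>The linear regression property of the exchangeable pair: zero row sums remove
    the mixed entries, so the average of \<open>d\<close> over all transpositions is a multiple of
    \<open>h\<close>. One factor of h^4 can thus be traded for \<open>d\<close>.\<close>
  have sum_d: "(\<Sum>k\<in>{1..n}. \<Sum>l\<in>{1..n}. d k l \<sigma>) = 2 * real n * h \<sigma>" if s: "\<sigma> \<in> Sym n" for \<sigma>
  proof -
    have "(\<Sum>k\<in>{1..n}. \<Sum>l\<in>{1..n}. d k l \<sigma>)
      = (\<Sum>k\<in>{1..n}. \<Sum>l\<in>{1..n}. u k (\<sigma> k) + u l (\<sigma> l) - u k (\<sigma> l) - u l (\<sigma> k))"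
      by (intro sum.cong refl d_eq)
    also have "\<dots> = 2 * real n * h \<sigma> - (\<Sum>k\<in>{1..n}. \<Sum>l\<in>{1..n}. u k (\<sigma> l))
        - (\<Sum>k\<in>{1..n}. \<Sum>l\<in>{1..n}. u l (\<sigma> k))"
      by (simp add: sum.distrib sum_subtractf h_def sum_distrib_left mult.assoc)
    also have "(\<Sum>k\<in>{1..n}. \<Sum>l\<in>{1..n}. u k (\<sigma> l)) = 0"
      using reindex[OF s] row by simp
    also have "(\<Sum>k\<in>{1..n}. \<Sum>l\<in>{1..n}. u l (\<sigma> k)) = 0"
      by (subst sum.swap) (use reindex[OF s] row in simp)
    finally show ?thesis by simp
  qed
  have sum_d2: "(\<Sum>k\<in>{1..n}. \<Sum>l\<in>{1..n}. (d k l \<sigma>)\<^sup>2) \<le> 8 * S + 8 * real n * V \<sigma>" if s: "\<sigma> \<in> Sym n" for \<sigma>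
  proof -
    have four: "(a + b - c - e)\<^sup>2 \<le> 4 * (a\<^sup>2 + b\<^sup>2 + c\<^sup>2 + e\<^sup>2)" for a b c e :: real
    proof -
      have "4 * (a\<^sup>2 + b\<^sup>2 + c\<^sup>2 + e\<^sup>2) - (a + b - c - e)\<^sup>2
        = (a - b)\<^sup>2 + (a + c)\<^sup>2 + (a + e)\<^sup>2 + (b + c)\<^sup>2 + (b + e)\<^sup>2 + (c - e)\<^sup>2"
        by (simp add: power2_eq_square algebra_simps)
      also have "\<dots> \<ge> 0" by simp
      finally show ?thesis by simp
    qed
    have "(\<Sum>k\<in>{1..n}. \<Sum>l\<in>{1..n}. (d k l \<sigma>)\<^sup>2)
      \<le> (\<Sum>k\<in>{1..n}. \<Sum>l\<in>{1..n}. 4 * ((u k (\<sigma> k))\<^sup>2 + (u l (\<sigma> l))\<^sup>2 + (u k (\<sigma> l))\<^sup>2 + (u l (\<sigma> k))\<^sup>2))"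
      by (intro sum_mono) (simp only: d_eq four)
    also have "\<dots> = 8 * real n * V \<sigma> + 4 * (\<Sum>k\<in>{1..n}. \<Sum>l\<in>{1..n}. (u k (\<sigma> l))\<^sup>2)
        + 4 * (\<Sum>k\<in>{1..n}. \<Sum>l\<in>{1..n}. (u l (\<sigma> k))\<^sup>2)"
      by (simp add: sum.distrib V_def flip: sum_distrib_left)
    also have "(\<Sum>k\<in>{1..n}. \<Sum>l\<in>{1..n}. (u k (\<sigma> l))\<^sup>2) = S"
      unfolding S_def by (intro sum.cong refl reindex[OF s])
    also have "(\<Sum>k\<in>{1..n}. \<Sum>l\<in>{1..n}. (u l (\<sigma> k))\<^sup>2) = S"
      unfolding S_def by (subst sum.swap) (intro sum.cong refl reindex[OF s])
    finally show ?thesis by simp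
  qed
  \<comment> \<open>Since \<open>d\<close> changes sign under the transposition, the sum equals half
    the sum of d (x^3 - y^3) with x - y = d. Factoring the difference of cubes produces a second
    factor \<open>d\<close>.\<close>
  have swap: "(\<Sum>\<sigma>\<in>Sym n. d k l \<sigma> * (h \<sigma>) ^ 3) \<le> 3 / 2 * (\<Sum>\<sigma>\<in>Sym n. (d k l \<sigma>)\<^sup>2 * (h \<sigma>)\<^sup>2)"
    if kl: "k \<in> {1..n}" "l \<in> {1..n}" for k l
  proof -
    let ?t = "transpose k l"
    have d': "d k l (\<sigma> \<circ> ?t) = - d k l \<sigma>" for \<sigma>
      by (simp add: d_def o_assoc[symmetric])
    have "(\<Sum>\<sigma>\<in>Sym n. d k l \<sigma> * (h \<sigma>) ^ 3) = (\<Sum>\<sigma>\<in>Sym n. - d k l \<sigma> * (h (\<sigma> \<circ> ?t)) ^ 3)"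
      using sum_Sym_compose_transpose[OF kl, of "\<lambda>\<sigma>. d k l \<sigma> * (h \<sigma>) ^ 3"] by (simp add: d')
    then have "2 * (\<Sum>\<sigma>\<in>Sym n. d k l \<sigma> * (h \<sigma>) ^ 3)
        = (\<Sum>\<sigma>\<in>Sym n. d k l \<sigma> * (h \<sigma>) ^ 3) + (\<Sum>\<sigma>\<in>Sym n. - d k l \<sigma> * (h (\<sigma> \<circ> ?t)) ^ 3)" by simp
    also have "\<dots> = (\<Sum>\<sigma>\<in>Sym n. d k l \<sigma> * ((h \<sigma>) ^ 3 - (h (\<sigma> \<circ> ?t)) ^ 3))"
      by (simp add: algebra_simps sum_subtractf sum_negf)
    also have "\<dots> \<le> (\<Sum>\<sigma>\<in>Sym n. 3 / 2 * ((d k l \<sigma>)\<^sup>2 * ((h \<sigma>)\<^sup>2 + (h (\<sigma> \<circ> ?t))\<^sup>2)))"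
    proof (intro sum_mono)
      fix \<sigma>
      let ?x = "h \<sigma>" and ?y = "h (\<sigma> \<circ> ?t)"
      have "d k l \<sigma> * (?x ^ 3 - ?y ^ 3) = (d k l \<sigma>)\<^sup>2 * (?x\<^sup>2 + ?x * ?y + ?y\<^sup>2)"
        unfolding d_def by (simp add: power2_eq_square power3_eq_cube algebra_simps)
      also have "\<dots> \<le> (d k l \<sigma>)\<^sup>2 * (3 / 2 * (?x\<^sup>2 + ?y\<^sup>2))"
        using sum_squares_bound[of ?x ?y] by (intro mult_left_mono) auto
      finally show "d k l \<sigma> * (?x ^ 3 - ?y ^ 3) \<le> 3 / 2 * ((d k l \<sigma>)\<^sup>2 * (?x\<^sup>2 + ?y\<^sup>2))" by (simp only: mult.left_commute)
    qed
    also have "\<dots> = 3 / 2 * ((\<Sum>\<sigma>\<in>Sym n. (d k l \<sigma>)\<^sup>2 * (h \<sigma>)\<^sup>2)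
        + (\<Sum>\<sigma>\<in>Sym n. (d k l \<sigma>)\<^sup>2 * (h (\<sigma> \<circ> ?t))\<^sup>2))"
      by (simp only: distrib_left sum.distrib flip: sum_distrib_left)
    also have "(\<Sum>\<sigma>\<in>Sym n. (d k l \<sigma>)\<^sup>2 * (h (\<sigma> \<circ> ?t))\<^sup>2) = (\<Sum>\<sigma>\<in>Sym n. (d k l \<sigma>)\<^sup>2 * (h \<sigma>)\<^sup>2)"
      using sum_Sym_compose_transpose[OF kl, of "\<lambda>\<sigma>. (d k l \<sigma>)\<^sup>2 * (h \<sigma>)\<^sup>2"] by (simp add: d')
    finally show ?thesis by simp
  qed
  define H where "H = (\<Sum>\<sigma>\<in>Sym n. (h \<sigma>) ^ 4)"
  have "2 * real n * H = (\<Sum>\<sigma>\<in>Sym n. (\<Sum>k\<in>{1..n}. \<Sum>l\<in>{1..n}. d k l \<sigma>) * (h \<sigma>) ^ 3)"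
    unfolding H_def sum_distrib_left by (intro sum.cong refl) (simp add: sum_d power3_eq_cube power4_eq_xxxx)
  also have "\<dots> = (\<Sum>\<sigma>\<in>Sym n. \<Sum>k\<in>{1..n}. \<Sum>l\<in>{1..n}. d k l \<sigma> * (h \<sigma>) ^ 3)"
    by (simp add: sum_distrib_right)
  also have "\<dots> = (\<Sum>k\<in>{1..n}. \<Sum>\<sigma>\<in>Sym n. \<Sum>l\<in>{1..n}. d k l \<sigma> * (h \<sigma>) ^ 3)"
    by (rule sum.swap)
  also have "\<dots> = (\<Sum>k\<in>{1..n}. \<Sum>l\<in>{1..n}. \<Sum>\<sigma>\<in>Sym n. d k l \<sigma> * (h \<sigma>) ^ 3)"
    by (intro sum.cong refl sum.swap)
  also have "\<dots> \<le> (\<Sum>k\<in>{1..n}. \<Sum>l\<in>{1..n}. 3 / 2 * (\<Sum>\<sigma>\<in>Sym n. (d k l \<sigma>)\<^sup>2 * (h \<sigma>)\<^sup>2))"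
    by (intro sum_mono swap)
  also have "\<dots> = 3 / 2 * (\<Sum>k\<in>{1..n}. \<Sum>l\<in>{1..n}. \<Sum>\<sigma>\<in>Sym n. (d k l \<sigma>)\<^sup>2 * (h \<sigma>)\<^sup>2)"
    by (simp only: sum_distrib_left)
  also have "(\<Sum>k\<in>{1..n}. \<Sum>l\<in>{1..n}. \<Sum>\<sigma>\<in>Sym n. (d k l \<sigma>)\<^sup>2 * (h \<sigma>)\<^sup>2)
     = (\<Sum>k\<in>{1..n}. \<Sum>\<sigma>\<in>Sym n. \<Sum>l\<in>{1..n}. (d k l \<sigma>)\<^sup>2 * (h \<sigma>)\<^sup>2)"
    by (intro sum.cong refl sum.swap)
  also have "\<dots> = (\<Sum>\<sigma>\<in>Sym n. \<Sum>k\<in>{1..n}. \<Sum>l\<in>{1..n}. (d k l \<sigma>)\<^sup>2 * (h \<sigma>)\<^sup>2)"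
    by (rule sum.swap)
  also have "\<dots> = (\<Sum>\<sigma>\<in>Sym n. (\<Sum>k\<in>{1..n}. \<Sum>l\<in>{1..n}. (d k l \<sigma>)\<^sup>2) * (h \<sigma>)\<^sup>2)"
    by (simp add: sum_distrib_right)
  also have "3 / 2 * \<dots> \<le> 3 / 2 * (\<Sum>\<sigma>\<in>Sym n. (8 * S + 8 * real n * V \<sigma>) * (h \<sigma>)\<^sup>2)"
    by (intro mult_left_mono sum_mono mult_right_mono sum_d2) auto
  also have "\<dots> = 2 * real n * (\<Sum>\<sigma>\<in>Sym n. 6 * (S / real n + V \<sigma>) * (h \<sigma>)\<^sup>2)"
    unfolding sum_distrib_left using n by (intro sum.cong refl) (simp add: field_simps)
  finally have "2 * real n * H \<le> 2 * real n * (\<Sum>\<sigma>\<in>Sym n. 6 * (S / real n + V \<sigma>) * (h \<sigma>)\<^sup>2)" .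
  then have "H \<le> (\<Sum>\<sigma>\<in>Sym n. 6 * (S / real n + V \<sigma>) * (h \<sigma>)\<^sup>2)"
    using n by (simp add: mult_le_cancel_left_pos)
  \<comment> \<open>AM-GM, tuned so that exactly half of \<open>H\<close> appears on the right and
    can be absorbed.\<close>
  also have "\<dots> \<le> (\<Sum>\<sigma>\<in>Sym n. (h \<sigma>) ^ 4 / 2 + 36 * ((S / real n)\<^sup>2 + (V \<sigma>)\<^sup>2))"
  proof (intro sum_mono)
    fix \<sigma>
    have am: "6 * (p + q) * x \<le> x\<^sup>2 / 2 + 36 * (p\<^sup>2 + q\<^sup>2)" for p q x :: real
    proof -
      have "x\<^sup>2 / 2 + 36 * (p\<^sup>2 + q\<^sup>2) - 6 * (p + q) * x = (x - 6 * (p + q))\<^sup>2 / 2 + 18 * (p - q)\<^sup>2"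
        by (simp add: power2_eq_square field_simps)
      also have "\<dots> \<ge> 0" by simp
      finally show ?thesis by simp
    qed
    show "6 * (S / real n + V \<sigma>) * (h \<sigma>)\<^sup>2 \<le> (h \<sigma>) ^ 4 / 2 + 36 * ((S / real n)\<^sup>2 + (V \<sigma>)\<^sup>2)"
      using am[of "S / real n" "V \<sigma>" "(h \<sigma>)\<^sup>2"] by simp
  qed
  also have "\<dots> = H / 2 + 36 * (fact n * (S / real n)\<^sup>2 + (\<Sum>\<sigma>\<in>Sym n. (V \<sigma>)\<^sup>2))"
    by (simp add: sum.distrib H_def card_Sym sum_divide_distrib flip: sum_distrib_left)
  finally have H: "H \<le> 72 * (fact n * (S / real n)\<^sup>2 + (\<Sum>\<sigma>\<in>Sym n. (V \<sigma>)\<^sup>2))" by simp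
  have "(\<Sum>\<sigma>\<in>Sym n. (V \<sigma>)\<^sup>2)
     \<le> fact (n - 1) * (\<Sum>i\<in>{1..n}. \<Sum>j\<in>{1..n}. ((u i j)\<^sup>2)\<^sup>2) + fact (n - 2) * S\<^sup>2"
    unfolding V_def S_def by (rule sum_Sym_sq_le) simp
  moreover have "(\<Sum>i\<in>{1..n}. \<Sum>j\<in>{1..n}. ((u i j)\<^sup>2)\<^sup>2) \<le> (\<Sum>i\<in>{1..n}. \<Sum>j\<in>{1..n}. \<delta>\<^sup>2 * (u i j)\<^sup>2)"
  proof (intro sum_mono)
    fix i j assume "i \<in> {1..n}" "j \<in> {1..n}"
    then have "(u i j)\<^sup>2 \<le> \<delta>\<^sup>2" using bnd power_mono[of "\<bar>u i j\<bar>" \<delta> 2] by simp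
    then show "((u i j)\<^sup>2)\<^sup>2 \<le> \<delta>\<^sup>2 * (u i j)\<^sup>2"
      unfolding power2_eq_square[of "(u i j)\<^sup>2"] by (intro mult_right_mono) auto
  qed
  then have "fact (n - 1) * (\<Sum>i\<in>{1..n}. \<Sum>j\<in>{1..n}. ((u i j)\<^sup>2)\<^sup>2) \<le> fact (n - 1) * (\<delta>\<^sup>2 * S)"
    unfolding S_def by (intro mult_left_mono) (simp_all add: sum_distrib_left)
  ultimately have V: "(\<Sum>\<sigma>\<in>Sym n. (V \<sigma>)\<^sup>2) \<le> fact (n - 1) * (\<delta>\<^sup>2 * S) + fact (n - 2) * S\<^sup>2" by linarith
  have f1: "fact n = real n * fact (n - 1)" using n by (subst fact_reduce) auto
  have "fact n * (S / real n)\<^sup>2 \<le> fact (n - 1) * (S\<^sup>2 / real n)"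
    unfolding f1 using n by (simp add: power2_eq_square)
  moreover have "fact (n - 2) * S\<^sup>2 \<le> fact (n - 1) * (2 * S\<^sup>2 / real n)"
  proof -
    have f2: "fact (n - 1) = (real n - 1) * fact (n - 2)" using n
      by (subst fact_reduce) (auto simp: of_nat_diff numeral_2_eq_2)
    have "S\<^sup>2 * real n \<le> S\<^sup>2 * (2 * (real n - 1))"
      using n by (intro mult_left_mono) auto
    then have "S\<^sup>2 \<le> (real n - 1) * (2 * S\<^sup>2 / real n)"
      using n by (simp add: pos_le_divide_eq algebra_simps)
    from mult_left_mono[OF this, of "fact (n - 2)"] show ?thesis unfolding f2 by (simp add: mult_ac)
  qed
  ultimately have "fact n * (S / real n)\<^sup>2 + (\<Sum>\<sigma>\<in>Sym n. (V \<sigma>)\<^sup>2)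
     \<le> fact (n - 1) * (S\<^sup>2 / real n) + (fact (n - 1) * (\<delta>\<^sup>2 * S) + fact (n - 1) * (2 * S\<^sup>2 / real n))"
    by (intro add_mono order.trans[OF V] order.refl)
  also have "\<dots> = fact (n - 1) * (3 * S\<^sup>2 / real n + \<delta>\<^sup>2 * S)" by (simp add: algebra_simps)
  finally have "72 * (fact n * (S / real n)\<^sup>2 + (\<Sum>\<sigma>\<in>Sym n. (V \<sigma>)\<^sup>2))
     \<le> 72 * (fact (n - 1) * (3 * S\<^sup>2 / real n + \<delta>\<^sup>2 * S))" by (rule mult_left_mono) simp
  with H have "H \<le> 72 * (fact (n - 1) * (3 * S\<^sup>2 / real n + \<delta>\<^sup>2 * S))" by (rule order.trans)
  then show ?thesis unfolding H_def h_def by (simp only: mult.assoc)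
qed

lemma sum_power4_le:
  fixes h :: "'a \<Rightarrow> real"
  assumes "finite A"
  shows "(\<Sum>x\<in>A. h x) ^ 4 \<le> real (card A) ^ 3 * (\<Sum>x\<in>A. h x ^ 4)"
proof -
  have 1: "(\<Sum>x\<in>A. h x)\<^sup>2 \<le> real (card A) * (\<Sum>x\<in>A. (h x)\<^sup>2)"
    using Cauchy_Schwarz_ineq_sum[of "\<lambda>_. 1" h A] by simp
  have 2: "(\<Sum>x\<in>A. (h x)\<^sup>2)\<^sup>2 \<le> real (card A) * (\<Sum>x\<in>A. h x ^ 4)"
    using Cauchy_Schwarz_ineq_sum[of "\<lambda>_. 1" "\<lambda>x. (h x)\<^sup>2" A] by simp
  have "(\<Sum>x\<in>A. h x) ^ 4 = ((\<Sum>x\<in>A. h x)\<^sup>2)\<^sup>2" by simp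
  also have "\<dots> \<le> (real (card A) * (\<Sum>x\<in>A. (h x)\<^sup>2))\<^sup>2"
    using 1 by (intro power_mono) auto
  also have "\<dots> = (real (card A))\<^sup>2 * (\<Sum>x\<in>A. (h x)\<^sup>2)\<^sup>2" by (simp add: power_mult_distrib)
  also have "\<dots> \<le> (real (card A))\<^sup>2 * (real (card A) * (\<Sum>x\<in>A. h x ^ 4))"
    using 2 by (intro mult_left_mono) auto
  finally show ?thesis by (simp add: power2_eq_square power3_eq_cube mult_ac)
qed

text \<open>The form value S is the sum over \<open>A\<close> of the deviations h along a
  permutation. Hoelder's inequality with exponent 4 bounds S^4 by a^3 times the fourth moment of h,
  which is controlled by the largest cell m. Since S \<le> 2 F a, a/n \<le> m and m \<le> F, the
  bracket 3 S/n + m^2 is at most 7 F m, whence S^3 \<le> 504 a^3 F^2 m with 504 = 72 times 7.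
  Comparison with S \<ge> \<theta> a F gives m.\<close>

lemma heavy_cell:
  assumes A: "A \<subseteq> Sym n" "A \<noteq> {}" and n: "n \<ge> 2" and \<theta>: "\<theta> > 0"
    and level1: "\<theta> * real (card A) * fact (n - 1) \<le> cell_form n (indicator A) (indicator A)"
  shows "\<exists>i\<in>{1..n}. \<exists>j\<in>{1..n}. \<theta> ^ 3 / 504 * fact (n - 1) \<le> real (card (A \<inter> coset1 n i j))"
proof -
  define F :: real where "F = fact (n - 1)"
  have F: "F > 0" by (simp add: F_def)
  define a where "a = real (card A)"
  have fin: "finite A" using A finite_subset_Sym by auto
  have a: "a > 0" using A fin by (simp add: a_def card_gt_0_iff)
  define S where "S = cell_form n (indicator A) (indicator A)"
  define u where "u = cell_dev n (indicator A)"
  define c where "c = (\<lambda>(i, j). real (card (A \<inter> coset1 n i j)))"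
  define m where "m = Max (c ` ({1..n} \<times> {1..n}))"
  have c_eq: "c (i, j) = cell n (indicator A) i j" for i j using A by (simp add: c_def cell_indicator)
  have one: "1 \<in> {1..n}" using n by auto
  have "m \<in> c ` ({1..n} \<times> {1..n})" unfolding m_def using one by (intro Max_in) auto
  then obtain i0 j0 where ij0: "i0 \<in> {1..n}" "j0 \<in> {1..n}" "m = c (i0, j0)" by auto
  have c_le: "c (i, j) \<le> m" if "i \<in> {1..n}" "j \<in> {1..n}" for i j
    unfolding m_def using that by (intro Max_ge) auto
  have c0: "c (i, j) \<ge> 0" for i j by (simp add: c_def)
  have m0: "m \<ge> 0" using ij0 c0 by simp
  have "card (A \<inter> coset1 n i0 j0) \<le> card (coset1 n i0 j0)" by (intro card_mono) auto
  then have "m \<le> real (fact (n - 1))" unfolding ij0(3) c_def using card_coset1[OF ij0(1,2)]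
    by (simp del: of_nat_fact)
  then have mF: "m \<le> F" by (simp add: F_def)
  have "a = (\<Sum>j\<in>{1..n}. c (1, j))"
    unfolding c_eq sum_cell_row[OF one] a_def using A by (simp add: sum_indicator_Sym)
  also have "\<dots> \<le> (\<Sum>j\<in>{1..n}. m)" using one by (intro sum_mono c_le)
  finally have am: "a / real n \<le> m" using n by (simp add: divide_le_eq mult.commute)
  have u_eq: "u i j = c (i, j) - a / real n" for i j
    unfolding u_def cell_dev_def c_eq a_def using A by (simp add: sum_indicator_Sym)
  \<comment> \<open>The largest cell also dominates the row mean a/n, so it bounds deviations of
    either sign.\<close>
  have u_le: "\<bar>u i j\<bar> \<le> m" if "i \<in> {1..n}" "j \<in> {1..n}" for i j
  proof -
    have "a / real n \<ge> 0" using a by simp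
    then show ?thesis unfolding u_eq abs_le_iff using c_le[OF that] c0[of i j] am by linarith
  qed
  have S_eq: "S = (\<Sum>i\<in>{1..n}. \<Sum>j\<in>{1..n}. (u i j)\<^sup>2)"
    unfolding S_def u_def using n by (simp add: cell_form_eq_dev power2_eq_square)
  define h where "h = (\<lambda>\<sigma>. \<Sum>i\<in>{1..n}. u i (\<sigma> i))"
  have "S = (\<Sum>\<sigma>\<in>Sym n. indicator A \<sigma> * h \<sigma>)"
    unfolding S_def h_def u_def using n by (simp only: sum_weighted_cells flip: sum_cell_dev_cell)
  also have "\<dots> = (\<Sum>\<sigma>\<in>A. h \<sigma>)"
    using A by (intro sum.mono_neutral_cong_right) auto
  finally have "S ^ 4 \<le> a ^ 3 * (\<Sum>\<sigma>\<in>A. h \<sigma> ^ 4)" using sum_power4_le[OF fin, of h] by (simp add: a_def)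
  also have "\<dots> \<le> a ^ 3 * (\<Sum>\<sigma>\<in>Sym n. h \<sigma> ^ 4)"
    using A a by (intro mult_left_mono sum_mono2) auto
  also have "\<dots> \<le> a ^ 3 * (72 * F * (3 * S\<^sup>2 / real n + m\<^sup>2 * S))"
    unfolding h_def F_def S_eq using a n u_le sum_cell_dev_row
    by (intro mult_left_mono fourth_moment_le) (auto simp: u_def simp del: atLeastAtMost_iff)
  finally have "S * S ^ 3 \<le> S * (a ^ 3 * (72 * F * (3 * S / real n + m\<^sup>2)))"
    by (simp add: power2_eq_square power3_eq_cube power4_eq_xxxx algebra_simps)
  moreover have S: "S > 0" using level1 mult_pos_pos[OF mult_pos_pos[OF \<theta> a] F] unfolding S_def a_def F_def by linarith
  ultimately have S3: "S ^ 3 \<le> a ^ 3 * (72 * F * (3 * S / real n + m\<^sup>2))" by simp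
  have "S \<le> fact n / (real n - 1) * a"
  proof -
    have "(\<Sum>\<sigma>\<in>Sym n. (indicator A \<sigma>)\<^sup>2) = (\<Sum>\<sigma>\<in>Sym n. indicator A \<sigma> :: real)"
      by (intro sum.cong refl) (simp add: indicator_def)
    then show ?thesis using cell_form_upper[OF n, of "indicator A"] A
      by (simp add: S_def a_def sum_indicator_Sym)
  qed
  also have "\<dots> \<le> (2 * F) * a"
  proof (rule mult_right_mono)
    have "fact n = real n * F" unfolding F_def using n by (subst fact_reduce) auto
    moreover have "real n * F \<le> (2 * (real n - 1)) * F" using n F by (intro mult_right_mono) auto
    ultimately show "fact n / (real n - 1) \<le> 2 * F" using n by (simp add: divide_le_eq algebra_simps)
  qed (use a in simp)
  finally have "3 * S / real n \<le> 3 * (2 * F * a) / real n" using n by (intro divide_right_mono) auto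
  also have "\<dots> = 6 * F * (a / real n)" by simp
  also have "\<dots> \<le> 6 * F * m" using am F by (intro mult_left_mono) auto
  finally have "3 * S / real n + m\<^sup>2 \<le> 6 * F * m + F * m"
    using mult_right_mono[OF mF m0] by (simp add: power2_eq_square)
  then have "3 * S / real n + m\<^sup>2 \<le> 7 * F * m" by simp
  then have "a ^ 3 * (72 * F * (3 * S / real n + m\<^sup>2)) \<le> a ^ 3 * (72 * F * (7 * F * m))"
    using a F by (intro mult_left_mono) auto
  moreover have "(\<theta> * a * F) ^ 3 \<le> S ^ 3"
    using level1 \<theta> a F unfolding S_def a_def F_def by (intro power_mono) auto
  ultimately have "(\<theta> * a * F) ^ 3 \<le> a ^ 3 * (72 * F * (7 * F * m))" using S3 by linarith
  then have "(a ^ 3 * F\<^sup>2) * (\<theta> ^ 3 * F) \<le> (a ^ 3 * F\<^sup>2) * (504 * m)"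
    by (simp add: power_mult_distrib power2_eq_square power3_eq_cube algebra_simps)
  then have "\<theta> ^ 3 * F \<le> 504 * m" using a F by simp
  then have "\<theta> ^ 3 / 504 * F \<le> m" by simp
  then show ?thesis using ij0 unfolding F_def c_def by (metis prod.case)
qed

lemma cell_form_Cauchy_Schwarz:
  assumes "n \<ge> 1"
  shows "(cell_form n f g)\<^sup>2 \<le> cell_form n f f * cell_form n g g"
  using Cauchy_Schwarz_ineq_sum[of "\<lambda>(i, j). cell_dev n f i j" "\<lambda>(i, j). cell_dev n g i j" "{1..n} \<times> {1..n}"]
  by (simp add: cell_form_eq_dev[OF assms] sum.cartesian_product case_prod_unfold power2_eq_square)

text \<open>The constant is \<open>504 \<cdot> 128\<^sup>3\<close>: the level-1 weight of \<open>A\<close> is at least \<open>1 / (128 M\<^sup>2)\<close> of its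
  maximum.\<close>

lemma large_cross_intersecting_heavy_cell:
  assumes n: "n \<ge> 102" and AB: "A \<subseteq> Sym n" "B \<subseteq> Sym n"
    and cross: "cross_intersecting n A B" and M: "1 \<le> M" "M \<le> n" "100 * n ^ 4 \<le> fact M"
    and large: "49 / 100 * (fact (n - 1))\<^sup>2 \<le> real (card A) * real (card B)"
  shows "\<exists>i\<in>{1..n}. \<exists>j\<in>{1..n}.
    fact (n - 1) / (1056964608 * real M ^ 6) \<le> real (card (A \<inter> coset1 n i j))"
proof -
  define F :: real where "F = fact (n - 1)"
  have F: "F > 0" by (simp add: F_def)
  have nF: "fact n = real n * F" unfolding F_def using n by (subst fact_reduce) auto
  define a b where "a = real (card A)" and "b = real (card B)"
  have ab: "49 / 100 * F\<^sup>2 \<le> a * b" using large by (simp add: a_def b_def F_def)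
  have "a * b > 0" using ab F by (smt (verit) zero_less_power zero_less_divide_iff mult_pos_pos)
  then have pos: "a > 0" "b > 0" by (auto simp: a_def b_def zero_less_mult_iff)
  then have ne: "A \<noteq> {}" "B \<noteq> {}" by (auto simp: a_def b_def)
  define Q where "Q = cell_form n (indicator A) (indicator B)"
  have n': "real n \<ge> 102" using n by simp
  have "card A \<le> card (Sym n)" using AB by (intro card_mono) auto
  then have "a \<le> real (fact n)" unfolding a_def card_Sym by (rule of_nat_mono)
  then have an: "a \<le> real n * F" using nF by simp
  have "real (100 * n ^ 4) \<le> real (fact M)" using M(3) by (rule of_nat_mono)
  then have M4: "100 * real n ^ 4 \<le> fact M" by simp
  have "a * (real n)\<^sup>2 * fact n / fact M \<le> (real n * F) * (real n)\<^sup>2 * (real n * F) / (100 * real n ^ 4)"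
    unfolding nF using an F n' M4 by (intro frac_le mult_right_mono) auto
  also have "\<dots> = F\<^sup>2 / 100" using n' by (simp add: power2_eq_square power4_eq_xxxx)
  finally have err: "a * (real n)\<^sup>2 * fact n / fact M \<le> F\<^sup>2 / 100" .
  define s where "s = sqrt (a * b)"
  have ss: "s * s = a * b" "s \<ge> 0" using pos by (auto simp: s_def)
  have sF: "7 / 10 * F \<le> s"
    unfolding s_def using ab F by (intro real_le_rsqrt) (simp add: power_mult_distrib power2_eq_square)
  \<comment> \<open>Equality holds at n = 102, whence that threshold. Together with
    \<open>sF\<close> the loss is at most 51/70 of ab.\<close>
  have "fact n / (2 * (real n - 2)) \<le> 51 / 100 * F"
  proof -
    have "real n * F \<le> (102 / 100 * (real n - 2)) * F" using n' F by (intro mult_right_mono) auto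
    then show ?thesis unfolding nF using n' by (simp add: divide_le_eq algebra_simps)
  qed
  then have "fact n / (2 * (real n - 2)) * s \<le> 51 / 100 * F * s" using ss by (intro mult_right_mono) auto
  also have "\<dots> \<le> 51 / 70 * s * s" using sF ss by (intro mult_right_mono) auto
  finally have mid: "fact n / (2 * (real n - 2)) * s \<le> 51 / 70 * (a * b)" using ss by simp
  have corr: "a * b \<le> (real M - 1) * Q + fact n / (2 * (real n - 2)) * s + a * (real n)\<^sup>2 * fact n / fact M"
    using cross_intersecting_correlation(1)[OF _ AB ne cross M(2)] n
    unfolding a_def b_def Q_def s_def by simp
  \<comment> \<open>The share of ab that survives: 1 - 51/70 - 1/49 is about 0.25.\<close>
  have "1 / 5 * p \<le> r" if "p \<le> r + q + e" "q \<le> 51 / 70 * p" "e \<le> f / 100" "49 / 100 * f \<le> p" "0 < p"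
    for p q r e f :: real using that by linarith
  from this[OF corr mid err ab \<open>a * b > 0\<close>] have MQ: "1 / 5 * (a * b) \<le> (real M - 1) * Q" .
  have Q: "Q > 0"
  proof (rule ccontr)
    assume "\<not> Q > 0"
    then have "(real M - 1) * Q \<le> 0" using M by (intro mult_nonneg_nonpos) auto
    then show False using MQ \<open>a * b > 0\<close> by linarith
  qed
  have "(real M - 1) * Q \<le> real M * Q" using Q by (intro mult_right_mono) auto
  then have MQ: "1 / 5 * (a * b) \<le> real M * Q" using MQ by linarith
  define QA QB where "QA = cell_form n (indicator A) (indicator A)" and "QB = cell_form n (indicator B) (indicator B)"
  have "QB \<le> fact n / (real n - 1) * b"
  proof -
    have "(\<Sum>\<sigma>\<in>Sym n. (indicator B \<sigma>)\<^sup>2) = (\<Sum>\<sigma>\<in>Sym n. indicator B \<sigma> :: real)"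
      by (intro sum.cong refl) (simp add: indicator_def)
    then show ?thesis using cell_form_upper[of n "indicator B"] AB n
      by (simp add: QB_def b_def sum_indicator_Sym)
  qed
  also have "\<dots> \<le> (2 * F) * b"
  proof (rule mult_right_mono)
    have "real n * F \<le> (2 * (real n - 1)) * F" using n' F by (intro mult_right_mono) auto
    then show "fact n / (real n - 1) \<le> 2 * F" using n' nF by (simp add: divide_le_eq algebra_simps)
  qed (use pos in simp)
  finally have QB: "QB \<le> 2 * F * b" .
  have QA0: "QA \<ge> 0" unfolding QA_def using n by (intro cell_form_nonneg) auto
  \<comment> \<open>Cauchy-Schwarz for the form transfers the correlation to \<open>A\<close> alone:
    as \<open>QB\<close> is at most 2 F b, \<open>QA\<close> is at least a constant multiple of a F
    / M^2.\<close>
  have "(1 / 5 * (a * b))\<^sup>2 \<le> (real M * Q)\<^sup>2" using MQ pos by (intro power_mono) auto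
  also have "\<dots> = (real M)\<^sup>2 * Q\<^sup>2" by (simp add: power_mult_distrib)
  also have "\<dots> \<le> (real M)\<^sup>2 * (QA * QB)"
    unfolding Q_def QA_def QB_def using n by (intro mult_left_mono cell_form_Cauchy_Schwarz) auto
  also have "\<dots> \<le> (real M)\<^sup>2 * (QA * (2 * F * b))"
    using QB QA0 by (intro mult_left_mono) auto
  finally have "b * (1 / 25 * a * (a * b)) \<le> b * ((real M)\<^sup>2 * QA * 2 * F)"
    by (simp add: power2_eq_square algebra_simps)
  then have 1: "1 / 25 * a * (a * b) \<le> (real M)\<^sup>2 * QA * 2 * F" using pos by simp
  have "1 / 25 * a * (49 / 100 * F\<^sup>2) \<le> 1 / 25 * a * (a * b)"
    using ab pos by (intro mult_left_mono) auto
  with 1 have "F * (49 / 2500 * a * F) \<le> F * (2 * (real M)\<^sup>2 * QA)"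
    by (simp add: power2_eq_square algebra_simps)
  then have "49 / 2500 * (a * F) \<le> 2 * ((real M)\<^sup>2 * QA)" using F by simp
  moreover have "a * F > 0" using pos F by simp
  \<comment> \<open>5000/49 is about 102, rounded up to a power of two.\<close>
  moreover have "p \<le> 128 * q" if "49 / 2500 * p \<le> 2 * q" "p > 0" for p q :: real
    using that by linarith
  ultimately have "a * F \<le> 128 * ((real M)\<^sup>2 * QA)" by blast
  then have "a * F \<le> (128 * (real M)\<^sup>2) * QA" by simp
  then have "1 / (128 * (real M)\<^sup>2) * real (card A) * fact (n - 1) \<le> QA"
    using M unfolding a_def F_def by (simp add: divide_le_eq mult.commute)
  from heavy_cell[OF AB(1) ne(1) _ _ this[unfolded QA_def]] n M
  have heavy: "\<exists>i\<in>{1..n}. \<exists>j\<in>{1..n}. (1 / (128 * (real M)\<^sup>2)) ^ 3 / 504 * fact (n - 1) \<le> real (card (A \<inter> coset1 n i j))"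
    by simp
  have eq: "(1 / (128 * (real M)\<^sup>2)) ^ 3 / 504 * fact (n - 1) = fact (n - 1) / (1056964608 * real M ^ 6)"
    by (simp add: power_divide power_mult_distrib flip: power_mult)
  show ?thesis using heavy unfolding eq .
qed

section \<open>Elements outside a heavy coset\<close>

lemma cross_intersecting_commute: "cross_intersecting n A B \<longleftrightarrow> cross_intersecting n B A"
proof -
  have "perm_intersect n \<sigma> \<tau> \<longleftrightarrow> perm_intersect n \<tau> \<sigma>" for \<sigma> \<tau>
    unfolding perm_intersect_def by metis
  then show ?thesis unfolding cross_intersecting_def by blast
qed

text \<open>Exchanging the values \<open>j\<close> and \<open>l\<close> moves the part of
  \<open>B\<close> with value \<open>l\<close> at \<open>i\<close> into the coset. A common value of
  \<sigma> and \<tau> occurs away from \<open>i\<close> and is neither \<open>j\<close> nor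
  \<open>l\<close>, so it survives the exchange and the two slices cross-intersect in
  \<open>Sym (n - 1)\<close>. The weak bound there, divided by the size of the heavy slice of
  \<open>A\<close>, leaves at most (M + 2)^2 L (n-2)!/(n-1) elements for each \<open>l\<close>; the
  sum over the n-1 values of \<open>l\<close> cancels the denominator.\<close>

lemma few_outside_heavy_coset:
  fixes L :: real
  assumes n: "n \<ge> 5" and AB: "A \<subseteq> Sym n" "B \<subseteq> Sym n" and cross: "cross_intersecting n A B"
    and M: "1 \<le> M" "M < n" "n ^ 4 \<le> fact M" and ij: "i \<in> {1..n}" "j \<in> {1..n}"
    and L: "L > 0" and heavy: "fact (n - 1) / L \<le> real (card (A \<inter> coset1 n i j))"
  shows "real (card (B - coset1 n i j)) \<le> (real M + 2)\<^sup>2 * L * fact (n - 2)"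
proof -
  let ?f = "slice_map n i j"
  let ?A = "?f ` (A \<inter> coset1 n i j)"
  let ?g = "\<lambda>l \<tau>. transpose j l \<circ> \<tau>"
  let ?B = "\<lambda>l. ?f ` (?g l ` (B \<inter> coset1 n i l))"
  define c where "c = (real M + 2)\<^sup>2"
  have inj: "inj_on ?f X" for X using inj_slice_map by (rule inj_on_subset) auto
  have cardA: "card ?A = card (A \<inter> coset1 n i j)" by (intro card_image inj)
  have f1: "fact (n - 1) = (real n - 1) * fact (n - 2)"
    using n by (subst fact_reduce) (auto simp: of_nat_diff numeral_2_eq_2 One_nat_def)
  have bound: "real (card (B \<inter> coset1 n i l)) \<le> c * L * fact (n - 2) / (real n - 1)"
    if l: "l \<in> {1..n} - {j}" for l
  proof -
    have sub: "?g l ` (B \<inter> coset1 n i l) \<subseteq> coset1 n i j"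
      using l ij by (auto simp: coset1_def Sym_def intro!: permutes_compose permutes_swap_id)
    have "inj_on (?g l) (B \<inter> coset1 n i l)"
    proof (rule inj_onI)
      fix \<sigma> \<tau> assume "?g l \<sigma> = ?g l \<tau>"
      then have "?g l (?g l \<sigma>) = ?g l (?g l \<tau>)" by simp
      then show "\<sigma> = \<tau>" by (simp add: o_assoc)
    qed
    then have cardB: "card (?B l) = card (B \<inter> coset1 n i l)"
      by (simp add: card_image inj)
    have "cross_intersecting (n - 1) ?A (?B l)"
      unfolding cross_intersecting_def
    proof safe
      fix \<sigma> \<tau> assume s: "\<sigma> \<in> A" "\<sigma> \<in> coset1 n i j" and t: "\<tau> \<in> B" "\<tau> \<in> coset1 n i l"
      obtain k where k: "k \<in> {1..n}" "\<sigma> k = \<tau> k"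
        using cross s(1) t(1) unfolding cross_intersecting_def perm_intersect_def by blast
      have vals: "\<sigma> i = j" "\<tau> i = l" and S: "\<sigma> \<in> Sym n" "\<tau> \<in> Sym n"
        using s t by (auto simp: coset1_def)
      have ki: "k \<noteq> i" using k vals l by auto
      then have "\<sigma> k \<noteq> j" "\<tau> k \<noteq> l" using vals Sym_inj[OF S(1), of k i] Sym_inj[OF S(2), of k i] by auto
      then have "\<sigma> k = ?g l \<tau> k" using k by simp
      moreover have "\<sigma> i = ?g l \<tau> i" using vals by simp
      ultimately have "{i, k} \<subseteq> {k \<in> {1..n}. \<sigma> k = ?g l \<tau> k}" using ij k by auto
      then have "card {i, k} \<le> agree n \<sigma> (?g l \<tau>)" unfolding agree_def by (intro card_mono) auto
      then have "2 \<le> agree n \<sigma> (?g l \<tau>)" using ki by simp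
      moreover have "?g l \<tau> \<in> coset1 n i j" using sub t by auto
      ultimately have "1 \<le> agree (n - 1) (?f \<sigma>) (?f (?g l \<tau>))"
        using agree_slice_map[OF ij(1) s(2)] by simp
      then show "perm_intersect (n - 1) (?f \<sigma>) (?f (?g l \<tau>))" by (simp add: perm_intersect_iff_agree)
    qed
    moreover have "?A \<subseteq> Sym (n - 1)" "?B l \<subseteq> Sym (n - 1)" using slice_map_Sym[OF ij] sub by auto
    moreover have "(n - 1) ^ 4 \<le> fact M" using M(3) power_mono[of "n - 1" n 4] by linarith
    ultimately have "real (card ?A) * real (card (?B l)) \<le> c * (fact (n - 1 - 1))\<^sup>2"
      unfolding c_def using n M by (intro cross_intersecting_weak_bound) auto
    moreover have "n - 1 - 1 = n - 2" by simp
    ultimately have w: "real (card (A \<inter> coset1 n i j)) * real (card (B \<inter> coset1 n i l)) \<le> c * (fact (n - 2))\<^sup>2"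
      unfolding cardA cardB by simp
    have "fact (n - 1) / L * real (card (B \<inter> coset1 n i l)) \<le> c * (fact (n - 2))\<^sup>2"
      using mult_right_mono[OF heavy, of "real (card (B \<inter> coset1 n i l))"] w by simp
    then have "fact (n - 2) * ((real n - 1) * real (card (B \<inter> coset1 n i l)))
       \<le> fact (n - 2) * (c * L * fact (n - 2))"
      unfolding f1 using L by (simp add: divide_le_eq power2_eq_square mult_ac)
    then have "(real n - 1) * real (card (B \<inter> coset1 n i l)) \<le> c * L * fact (n - 2)"
      by (rule mult_left_le_imp_le) simp
    then show ?thesis using n by (simp add: le_divide_eq mult.commute)
  qed
  have "B - coset1 n i j \<subseteq> (\<Union>l\<in>{1..n} - {j}. B \<inter> coset1 n i l)"
  proof
    fix \<tau> assume t: "\<tau> \<in> B - coset1 n i j"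
    then have "\<tau> \<in> Sym n" using AB by auto
    then have "\<tau> i \<in> {1..n} - {j}" "\<tau> \<in> coset1 n i (\<tau> i)"
      using t Sym_in_image[OF _ ij(1)] by (auto simp: coset1_def)
    then show "\<tau> \<in> (\<Union>l\<in>{1..n} - {j}. B \<inter> coset1 n i l)" using t by blast
  qed
  then have "card (B - coset1 n i j) \<le> card (\<Union>l\<in>{1..n} - {j}. B \<inter> coset1 n i l)"
    by (intro card_mono) auto
  also have "\<dots> \<le> (\<Sum>l\<in>{1..n} - {j}. card (B \<inter> coset1 n i l))" by (rule card_UN_le) simp
  finally have "real (card (B - coset1 n i j)) \<le> (\<Sum>l\<in>{1..n} - {j}. real (card (B \<inter> coset1 n i l)))"
    by (simp flip: of_nat_sum)
  also have "\<dots> \<le> (\<Sum>l\<in>{1..n} - {j}. c * L * fact (n - 2) / (real n - 1))"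
    by (intro sum_mono bound)
  also have "\<dots> = c * L * fact (n - 2)" using ij n by (simp add: of_nat_diff)
  finally show ?thesis by (simp add: c_def)
qed

section \<open>The cost of several permutations outside the coset\<close>

lemma sum_card_le_card_UN:
  assumes "finite K" "\<And>k. k \<in> K \<Longrightarrow> finite (E k)"
    and "\<And>k k'. k \<in> K \<Longrightarrow> k' \<in> K \<Longrightarrow> k \<noteq> k' \<Longrightarrow> card (E k \<inter> E k') \<le> b"
  shows "(\<Sum>k\<in>K. card (E k)) \<le> card (\<Union>k\<in>K. E k) + card K * (card K - 1) * b"
  using assms
proof (induction K rule: finite_induct)
  case (insert x K)
  have "card (E x \<inter> (\<Union>k\<in>K. E k)) \<le> card (\<Union>k\<in>K. E x \<inter> E k)"
    using insert by (intro card_mono) auto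
  also have "\<dots> \<le> (\<Sum>k\<in>K. card (E x \<inter> E k))" using insert by (intro card_UN_le) auto
  also have "\<dots> \<le> (\<Sum>k\<in>K. b)" using insert by (intro sum_mono) auto
  finally have 1: "card (E x \<inter> (\<Union>k\<in>K. E k)) \<le> card K * b" by simp
  have 2: "card (E x) + card (\<Union>k\<in>K. E k) = card (\<Union>k\<in>insert x K. E k) + card (E x \<inter> (\<Union>k\<in>K. E k))"
    using insert card_Un_Int[of "E x" "\<Union>k\<in>K. E k"] by auto
  have 3: "(\<Sum>k\<in>K. card (E k)) \<le> card (\<Union>k\<in>K. E k) + card K * (card K - 1) * b"
    using insert by auto
  have "card K + card K * (card K - 1) \<le> Suc (card K) * card K" by (cases "card K") auto
  then have "(card K + card K * (card K - 1)) * b \<le> Suc (card K) * card K * b" by (rule mult_le_mono1)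
  then show ?case using 1 2 3 insert by (simp add: algebra_simps)
qed simp

text \<open>Prescribing the value \<open>\<rho>1 k\<close> at a point \<open>k\<close> of
  \<open>K\<close> ensures a meeting with \<open>\<rho>1\<close>, and at least
  \<open>derangements (n - 2)\<close> of these permutations miss \<open>\<rho>2\<close>. Two such
  classes overlap in permutations with three prescribed values, which a Bonferroni inequality over
  ordered pairs subtracts. When \<open>B\<close> contains both, these permutations are lost to
  \<open>A\<close> in addition to those that miss \<open>\<rho>1\<close>.\<close>

lemma card_hitting_and_missing_ge:
  assumes ij: "i \<in> {1..n}" "j \<in> {1..n}" and \<rho>: "\<rho>1 \<in> Sym n" "\<rho>2 \<in> Sym n" "\<rho>2 i \<noteq> j"
    and K: "K \<subseteq> {1..n}" "\<And>k. k \<in> K \<Longrightarrow> k \<noteq> i \<and> \<rho>1 k \<noteq> j \<and> \<rho>1 k \<noteq> \<rho>2 k"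
  shows "card K * derangements (n - 2)
    \<le> card {\<sigma> \<in> coset1 n i j. perm_intersect n \<sigma> \<rho>1 \<and> \<not> perm_intersect n \<sigma> \<rho>2}
      + card K * (card K - 1) * fact (n - 3)"
proof -
  let ?E = "\<lambda>k. {\<sigma> \<in> Sym n. \<sigma> i = j \<and> \<sigma> k = \<rho>1 k \<and> \<not> perm_intersect n \<sigma> \<rho>2}"
  let ?T = "{\<sigma> \<in> coset1 n i j. perm_intersect n \<sigma> \<rho>1 \<and> \<not> perm_intersect n \<sigma> \<rho>2}"
  have fin: "finite K" using K finite_subset by blast
  have "card K * derangements (n - 2) = (\<Sum>k\<in>K. derangements (n - 2))" by simp
  also have "\<dots> \<le> (\<Sum>k\<in>K. card (?E k))"
  proof (intro sum_mono card_two_values_avoiding_ge)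
    fix k assume k: "k \<in> K"
    show kn: "k \<in> {1..n}" using k K by blast
    show "i \<noteq> k" "j \<noteq> \<rho>1 k" "\<rho>2 k \<noteq> \<rho>1 k" using K(2)[OF k] by auto
    from kn show "\<rho>1 k \<in> {1..n}" using Sym_in_image[OF \<rho>(1)] by simp
  qed (use ij \<rho> in auto)
  also have "\<dots> \<le> card (\<Union>k\<in>K. ?E k) + card K * (card K - 1) * fact (n - 3)"
  proof (rule sum_card_le_card_UN[OF fin])
    show "finite (?E k)" for k by (rule finite_subset[OF _ finite_Sym[of n]]) auto
    fix k k' assume k: "k \<in> K" "k' \<in> K" "k \<noteq> k'"
    have "card (?E k \<inter> ?E k') \<le> card {\<sigma> \<in> Sym n. \<sigma> i = j \<and> \<sigma> k = \<rho>1 k \<and> \<sigma> k' = \<rho>1 k'}"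
      by (intro card_mono) auto
    also have "\<dots> \<le> fact (n - 3)" using k K ij by (intro card_three_values_le) (metis subsetD)+
    finally show "card (?E k \<inter> ?E k') \<le> fact (n - 3)" .
  qed
  also have "card (\<Union>k\<in>K. ?E k) \<le> card ?T"
  proof (rule card_mono)
    show "finite ?T" by (rule finite_subset[OF _ finite_coset1[of n i j]]) auto
    show "(\<Union>k\<in>K. ?E k) \<subseteq> ?T" using K by (auto simp: coset1_def perm_intersect_def)
  qed
  finally show ?thesis by simp
qed

text \<open>Otherwise the point sent to \<open>j\<close> by \<open>\<rho>2\<close> is sent there by
  \<open>\<rho>1\<close> too, so the permutations can differ only at \<open>i\<close>, and then they
  coincide. The point found serves as a one-element \<open>K\<close> in
  \<open>card_hitting_and_missing_ge\<close>.\<close>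

lemma ex_disagreement_off_cell:
  assumes ij: "i \<in> {1..n}" "j \<in> {1..n}" and \<rho>: "\<rho>1 \<in> Sym n" "\<rho>2 \<in> Sym n"
    and ne: "\<rho>1 i \<noteq> j" "\<rho>2 i \<noteq> j" "\<rho>1 \<noteq> \<rho>2"
  shows "\<exists>k\<in>{1..n}. k \<noteq> i \<and> \<rho>1 k \<noteq> j \<and> \<rho>1 k \<noteq> \<rho>2 k"
proof (rule ccontr)
  assume "\<not> ?thesis"
  then have agr: "\<rho>1 k = \<rho>2 k" if "k \<in> {1..n}" "k \<noteq> i" "\<rho>1 k \<noteq> j" for k using that by blast
  have p: "\<rho>1 permutes {1..n}" "\<rho>2 permutes {1..n}" using \<rho> by (auto simp: Sym_def)
  obtain c where c: "c \<in> {1..n}" "\<rho>2 c = j"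
    using permutes_image[OF p(2)] ij(2) by (metis imageE)
  have c1: "\<rho>1 c = j"
  proof (rule ccontr)
    assume "\<rho>1 c \<noteq> j"
    moreover have "c \<noteq> i" using c ne by auto
    ultimately have "\<rho>1 c = \<rho>2 c" using agr c by blast
    then show False using c \<open>\<rho>1 c \<noteq> j\<close> by simp
  qed
  have off: "\<rho>1 k = \<rho>2 k" if "k \<noteq> i" for k
  proof (cases "k \<in> {1..n}")
    case True
    show ?thesis
    proof (cases "\<rho>1 k = j")
      case True
      then have "k = c" using c1 Sym_inj[OF \<rho>(1)] by metis
      then show ?thesis using c c1 by simp
    qed (use agr True that in auto)
  next
    case False
    then show ?thesis using permutes_not_in[OF p(1)] permutes_not_in[OF p(2)] by simp
  qed
  obtain e where e: "\<rho>1 e = \<rho>2 i" using permutes_surj[OF p(1)] by (metis surjD)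
  have "e = i" using off[of e] e Sym_inj[OF \<rho>(2), of e i] by auto
  then have "\<rho>1 i = \<rho>2 i" using e by simp
  then have "\<rho>1 = \<rho>2" using off by (metis ext)
  then show False using ne by simp
qed

lemma card_coset1_hitting:
  assumes "i \<in> {1..n}" "j \<in> {1..n}" "\<rho> \<in> Sym n" "\<rho> i \<noteq> j"
  shows "card {\<sigma> \<in> coset1 n i j. perm_intersect n \<sigma> \<rho>} + (derangements (n - 1) + derangements (n - 2)) = fact (n - 1)"
proof -
  have "coset1 n i j = {\<sigma> \<in> coset1 n i j. perm_intersect n \<sigma> \<rho>} \<union> {\<sigma> \<in> coset1 n i j. \<not> perm_intersect n \<sigma> \<rho>}"
    by auto
  moreover have "card ({\<sigma> \<in> coset1 n i j. perm_intersect n \<sigma> \<rho>} \<union> {\<sigma> \<in> coset1 n i j. \<not> perm_intersect n \<sigma> \<rho>})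
    = card {\<sigma> \<in> coset1 n i j. perm_intersect n \<sigma> \<rho>} + card {\<sigma> \<in> coset1 n i j. \<not> perm_intersect n \<sigma> \<rho>}"
    by (intro card_Un_disjoint) (auto intro: finite_subset[OF _ finite_coset1[of n i j]])
  ultimately show ?thesis using card_coset1[OF assms(1,2)] card_coset1_avoiding[OF assms] by simp
qed

text \<open>If \<open>C\<close> is small, any two elements will do. If it is large, it contains two permutations with few
  agreements.\<close>

lemma far_pair:
  fixes t :: nat
  assumes n: "n \<ge> 5" and ij: "i \<in> {1..n}" "j \<in> {1..n}"
    and C: "C \<subseteq> Sym n" "\<And>\<rho>. \<rho> \<in> C \<Longrightarrow> \<rho> i \<noteq> j" "card C \<ge> 2" "6 * card C \<le> t * fact (n - 2)"
    and M: "M \<le> n" "3 * n\<^sup>2 < fact M" and t: "6 * t \<le> n - 2" "t + M + 1 \<le> n"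
  shows "\<exists>\<rho>1\<in>C. \<exists>\<rho>2\<in>C. card C
    \<le> card {\<sigma> \<in> coset1 n i j. perm_intersect n \<sigma> \<rho>1 \<and> \<not> perm_intersect n \<sigma> \<rho>2}"
proof (cases "card C \<le> derangements (n - 2)")
  case True
  obtain \<rho>1 \<rho>2 where r: "\<rho>1 \<in> C" "\<rho>2 \<in> C" "\<rho>1 \<noteq> \<rho>2"
    using C(3) by (metis card_le_Suc0_iff_eq card.infinite not_less_eq_eq numeral_2_eq_2 zero_le)
  then obtain k where k: "k \<in> {1..n}" "k \<noteq> i" "\<rho>1 k \<noteq> j" "\<rho>1 k \<noteq> \<rho>2 k"
    using ex_disagreement_off_cell[OF ij, of \<rho>1 \<rho>2] C by blast
  have R: "\<rho>1 \<in> Sym n" "\<rho>2 \<in> Sym n" "\<rho>2 i \<noteq> j" using r C(1,2) by auto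
  \<comment> \<open>A single point of disagreement already gives this many permutations, and there
    are no overlaps to subtract.\<close>
  have "derangements (n - 2)
    \<le> card {\<sigma> \<in> coset1 n i j. perm_intersect n \<sigma> \<rho>1 \<and> \<not> perm_intersect n \<sigma> \<rho>2}"
    using card_hitting_and_missing_ge[OF ij R, of "{k}"] k by simp
  then show ?thesis using True r by (meson order.trans)
next
  case False
  have f: "fact n = n * (n - 1) * (fact (n - 2) :: nat)"
    using n by (subst fact_reduce, simp, subst fact_reduce, simp) (simp add: numeral_2_eq_2 One_nat_def)
  have d: "fact (n - 2) \<le> 3 * derangements (n - 2)" using n by (intro derangements_bounds) auto
  obtain \<rho>1 where r1: "\<rho>1 \<in> C" using C(3) by fastforce
  \<comment> \<open>Now \<open>C\<close> has more than (n-2)!/3 elements, whereas at most n!/M!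
    permutations agree with \<open>\<rho>1\<close> in \<open>M\<close> or more points.\<close>
  have "\<not> C \<subseteq> {\<tau> \<in> Sym n. agree n \<rho>1 \<tau> \<ge> M}"
  proof
    assume "C \<subseteq> {\<tau> \<in> Sym n. agree n \<rho>1 \<tau> \<ge> M}"
    then have "card C \<le> card {\<tau> \<in> Sym n. agree n \<rho>1 \<tau> \<ge> M}" by (intro card_mono) auto
    then have "card C * fact M \<le> fact n"
      using card_agree_ge[of \<rho>1 n M] r1 C M by (meson subsetD mult_le_mono1 order_trans)
    then have "3 * (card C * fact M) \<le> 3 * fact n" by simp
    moreover have "fact (n - 2) * fact M \<le> 3 * card C * fact M"
      using d False by (intro mult_le_mono1) linarith
    ultimately have "fact (n - 2) * fact M \<le> 3 * (fact n :: nat)" by linarith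
    also have "\<dots> = fact (n - 2) * (3 * (n * (n - 1)))" unfolding f by (simp only: mult_ac)
    finally have "fact M \<le> 3 * (n * (n - 1))" by simp
    also have "\<dots> \<le> 3 * n\<^sup>2" by (simp add: power2_eq_square)
    finally show False using M by simp
  qed
  then obtain \<rho>2 where r2: "\<rho>2 \<in> C" "agree n \<rho>1 \<rho>2 < M" using C(1) by (force simp: not_le)
  have R: "\<rho>1 \<in> Sym n" "\<rho>2 \<in> Sym n" "\<rho>1 i \<noteq> j" "\<rho>2 i \<noteq> j" using r1 r2 C by auto
  let ?K = "{k \<in> {1..n}. k \<noteq> i \<and> \<rho>1 k \<noteq> j \<and> \<rho>1 k \<noteq> \<rho>2 k}"
  let ?G = "{k \<in> {1..n}. \<rho>1 k = \<rho>2 k}"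
  \<comment> \<open>Excluded from \<open>?K\<close> are fewer than \<open>M\<close> agreements, the
    point \<open>i\<close> and the preimage of \<open>j\<close>, so at least n - M - 1 points are
    available.\<close>
  have "{1..n} \<subseteq> ?K \<union> ?G \<union> {i} \<union> {inv \<rho>1 j}"
    using R(1) permutes_inverses(2)[of \<rho>1 "{1..n}"] by (auto simp: Sym_def)
  then have "card {1..n} \<le> card (?K \<union> ?G \<union> {i} \<union> {inv \<rho>1 j})" by (intro card_mono) auto
  also have "\<dots> \<le> card ?K + card ?G + 1 + 1"
    by (intro order.trans[OF card_Un_le] add_mono) auto
  finally have "t \<le> card ?K" using r2 t unfolding agree_def by simp
  then obtain K where K: "K \<subseteq> ?K" "card K = t" by (meson obtain_subset_with_card_n)
  have "t * derangements (n - 2)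
    \<le> card {\<sigma> \<in> coset1 n i j. perm_intersect n \<sigma> \<rho>1 \<and> \<not> perm_intersect n \<sigma> \<rho>2} + t * (t - 1) * fact (n - 3)"
    unfolding K(2)[symmetric] using K(1) by (intro card_hitting_and_missing_ge ij R) auto
  \<comment> \<open>The overlaps cost at most t (n-2)!/6 out of a main term of at least t (n-2)!/3.
    The difference t (n-2)!/6 is the bound on \<open>card C\<close>, whence the factor 6.\<close>
  moreover have "6 * (t * (t - 1) * fact (n - 3)) \<le> t * fact (n - 2)"
  proof -
    have "fact (n - 2) = (n - 2) * (fact (n - 3) :: nat)"
      using n by (subst fact_reduce) (simp_all add: numeral_3_eq_3 numeral_2_eq_2 One_nat_def)
    moreover have "6 * (t - 1) * fact (n - 3) \<le> (n - 2) * (fact (n - 3) :: nat)"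
      using t by (intro mult_le_mono1) simp
    ultimately have "6 * (t - 1) * fact (n - 3) \<le> (fact (n - 2) :: nat)" by simp
    from mult_le_mono2[OF this, of t] show ?thesis by (simp add: mult_ac)
  qed
  moreover have "t * fact (n - 2) \<le> t * (3 * derangements (n - 2))" using d by (intro mult_le_mono2)
  ultimately have "card C \<le> card {\<sigma> \<in> coset1 n i j. perm_intersect n \<sigma> \<rho>1 \<and> \<not> perm_intersect n \<sigma> \<rho>2}"
    using C(4) by linarith
  then show ?thesis using r1 r2 by blast
qed

text \<open>Let c be the number of elements of \<open>B\<close> outside the coset. If c \<ge> 2,
  \<open>far_pair\<close> takes at least c further elements from \<open>A\<close>, so the product is
  at most (W - c)(F + c), which is below W (F + 1) because W \<le> F. Hence c = 1, and both factors
  must attain their maxima \<open>W\<close> and \<open>F + 1\<close>, which determines the two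
  families.\<close>

lemma extremal_from_one_sided:
  fixes t :: nat
  assumes n: "n \<ge> 5" and AB: "A \<subseteq> Sym n" "B \<subseteq> Sym n" and cross: "cross_intersecting n A B"
    and ij: "i \<in> {1..n}" "j \<in> {1..n}"
    and A: "A \<subseteq> coset1 n i j" and B: "\<not> B \<subseteq> coset1 n i j"
    and small: "6 * card (B - coset1 n i j) \<le> t * fact (n - 2)"
    and M: "M \<le> n" "3 * n\<^sup>2 < fact M" and t: "6 * t \<le> n - 2" "t + M + 1 \<le> n"
    and large: "(fact (n - 1) - (derangements (n - 1) + derangements (n - 2))) * (fact (n - 1) + 1) \<le> card A * card B"
  shows "\<exists>\<rho>\<in>Sym n. \<rho> i \<noteq> j \<and> A = {\<sigma> \<in> coset1 n i j. perm_intersect n \<sigma> \<rho>} \<and> B = coset1 n i j \<union> {\<rho>}"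
proof -
  define F :: nat where "F = fact (n - 1)"
  define C where "C = B - coset1 n i j"
  define W where "W = F - (derangements (n - 1) + derangements (n - 2))"
  let ?X = "\<lambda>\<rho>. {\<sigma> \<in> coset1 n i j. perm_intersect n \<sigma> \<rho>}"
  have finX: "finite (?X \<rho>)" for \<rho> by (rule finite_subset[OF _ finite_coset1[of n i j]]) auto
  have C: "C \<subseteq> Sym n" "\<rho> \<in> C \<Longrightarrow> \<rho> i \<noteq> j" "C \<noteq> {}" for \<rho>
    using AB B by (auto simp: C_def coset1_def)
  have finC: "finite C" using C(1) finite_subset_Sym by auto
  have cardX: "card (?X \<rho>) = W" if "\<rho> \<in> C" for \<rho>
    using card_coset1_hitting[OF ij, of \<rho>] C that unfolding W_def F_def by auto
  have AX: "A \<subseteq> ?X \<rho>" if "\<rho> \<in> C" for \<rho>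
    using A cross that unfolding cross_intersecting_def C_def by auto
  \<comment> \<open>Positivity shows that the subtraction of natural numbers in \<open>W\<close> is
    not truncated, and it makes the later comparisons strict.\<close>
  have W0: "W > 0"
  proof -
    have "2 * derangements (n - 1) \<le> F" "2 * derangements (n - 2) \<le> fact (n - 2)"
      unfolding F_def using n by (auto intro!: derangements_bounds)
    moreover have "fact (n - 2) < F" unfolding F_def using n by (intro fact_less_mono_nat) auto
    ultimately show ?thesis unfolding W_def by simp
  qed
  have BT: "B \<subseteq> coset1 n i j \<union> C" by (auto simp: C_def)
  have cT: "card (coset1 n i j) = F" unfolding F_def using ij by (rule card_coset1)
  have Bcard: "card B \<le> F + card C"
    using card_mono[OF _ BT] card_Un_le[of "coset1 n i j" C] finC unfolding cT by simp
  have big: "W * (F + 1) \<le> card A * card B" using large by (simp add: W_def F_def)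
  have "card C < 2"
  proof (rule ccontr)
    assume "\<not> card C < 2"
    then obtain \<rho>1 \<rho>2 where r: "\<rho>1 \<in> C" "\<rho>2 \<in> C"
      and g: "card C \<le> card {\<sigma> \<in> coset1 n i j. perm_intersect n \<sigma> \<rho>1 \<and> \<not> perm_intersect n \<sigma> \<rho>2}"
      using far_pair[OF n ij C(1) _ _ _ M t] C(2) small C_def by auto
    let ?G = "{\<sigma> \<in> coset1 n i j. perm_intersect n \<sigma> \<rho>1 \<and> \<not> perm_intersect n \<sigma> \<rho>2}"
    have "A \<inter> ?G = {}" using AX[OF r(2)] by auto
    moreover have "A \<union> ?G \<subseteq> ?X \<rho>1" using AX[OF r(1)] by auto
    moreover have "finite A" using AX[OF r(1)] finX by (rule finite_subset)
    moreover have "finite ?G" by (rule finite_subset[OF _ finX[of \<rho>1]]) auto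
    ultimately have "card A + card ?G \<le> W"
      using card_mono[OF finX[of \<rho>1], of "A \<union> ?G"] cardX[OF r(1)] card_Un_disjoint[of A ?G] by linarith
    then have "card A + card C \<le> W" using g by simp
    then have a: "int (card A) \<le> int W - int (card C)" by simp
    have b: "int (card B) \<le> int F + int (card C)" using Bcard by simp
    have c: "int (card C) \<ge> 1" using \<open>\<not> card C < 2\<close> by simp
    have WF: "int W \<le> int F" by (simp add: W_def)
    have "int (card A) * int (card B) \<le> (int W - int (card C)) * (int F + int (card C))"
      using a b by (intro mult_mono) auto
    also have "\<dots> = int W * int F - int (card C) * (int F - int W) - int (card C) * int (card C)"
      by (simp add: algebra_simps)
    also have "\<dots> < int W * int F + int W"
    proof -
      have "int (card C) * (int F - int W) \<ge> 0" using c WF by (intro mult_nonneg_nonneg) auto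
      moreover have "int (card C) * int (card C) \<ge> 0" by simp
      ultimately show ?thesis using W0 by linarith
    qed
    also have "\<dots> = int (W * (F + 1))" by (simp add: algebra_simps)
    finally have "card A * card B < W * (F + 1)" by (simp only: of_nat_less_iff flip: of_nat_mult)
    then show False using big by simp
  qed
  then have "card C = 1" using C(3) finC by (simp add: One_nat_def less_2_cases_iff)
  then obtain \<rho> where \<rho>: "C = {\<rho>}" by (auto simp: card_1_singleton_iff One_nat_def)
  have r: "\<rho> \<in> Sym n" "\<rho> i \<noteq> j" using C \<rho> by auto
  have A': "A \<subseteq> ?X \<rho>" using AX \<rho> by auto
  have Ale: "card A \<le> W" using card_mono[OF finX A'] cardX \<rho> by simp
  have Ble: "card B \<le> F + 1" using Bcard \<rho> by simp
  have "card A = W"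
  proof (rule ccontr)
    assume "card A \<noteq> W"
    then have "card A * card B \<le> (W - 1) * (F + 1)" using Ale Ble by (intro mult_le_mono) auto
    also have "\<dots> < W * (F + 1)" using W0 by simp
    finally show False using big by simp
  qed
  moreover have "card B = F + 1"
  proof (rule ccontr)
    assume "card B \<noteq> F + 1"
    then have "card A * card B \<le> W * F" using Ale Ble by (intro mult_le_mono) auto
    also have "\<dots> < W * (F + 1)" using W0 by simp
    finally show False using big by simp
  qed
  moreover have "card (coset1 n i j \<union> {\<rho>}) = F + 1"
    using r cT by (subst card_Un_disjoint) (auto simp: coset1_def intro: finite_subset[OF _ finite_Sym])
  ultimately have "A = ?X \<rho>" "B = coset1 n i j \<union> {\<rho>}"
    using card_subset_eq[OF finX A'] cardX \<rho> BT card_subset_eq[of "coset1 n i j \<union> {\<rho>}" B] by auto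
  then show ?thesis using r by blast
qed

section \<open>Extremal families\<close>

lemma card_coset1_Int_le:
  assumes "i \<in> {1..n}" "j \<in> {1..n}" "k \<in> {1..n}" "l \<in> {1..n}" "(i, j) \<noteq> (k, l)"
  shows "card (coset1 n i j \<inter> coset1 n k l) \<le> fact (n - 2)"
proof (cases "i \<noteq> k \<and> j \<noteq> l")
  case True
  have "coset1 n i j \<inter> coset1 n k l = {\<sigma> \<in> Sym n. \<sigma> i = j \<and> \<sigma> k = l}" by (auto simp: coset1_def)
  then show ?thesis using card_two_values[OF assms(1-4)] True by simp
next
  case False
  then have "coset1 n i j \<inter> coset1 n k l = {}" using assms(5) by (auto simp: coset1_def Sym_inj)
  then show ?thesis by simp
qed

text \<open>1/L is the share of a coset guaranteed by the heavy cell, and K (n-2)! bounds the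
  elements outside. If the heavy cosets of \<open>A\<close> and \<open>B\<close> differed, the heavy
  part of \<open>A\<close> would consist of an intersection of two cosets and few outsiders, at most
  (1 + K)(n-2)! elements, which is less than (n-1)!/L. If both families left the common coset, each
  would have about W elements at most, and W^2 is well below W F. So one family lies inside
  it.\<close>

lemma large_cross_intersecting_extremal:
  fixes n M :: nat
  defines "L \<equiv> 1056964608 * M ^ 6"
  defines "K \<equiv> (M + 2)\<^sup>2 * L"
  assumes M: "1 \<le> M" "100 * n ^ 4 \<le> fact M" and n: "100 * L * (1 + K) + M + 100 \<le> n"
    and AB: "A \<subseteq> Sym n" "B \<subseteq> Sym n" and cross: "cross_intersecting n A B"
    and not_coset: "\<not> (\<exists>i\<in>{1..n}. \<exists>j\<in>{1..n}. A \<subseteq> coset1 n i j \<and> B \<subseteq> coset1 n i j)"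
    and large: "(fact (n - 1) - (derangements (n - 1) + derangements (n - 2))) * (fact (n - 1) + 1) \<le> card A * card B"
  shows "\<exists>i\<in>{1..n}. \<exists>j\<in>{1..n}. \<exists>\<rho>\<in>Sym n. \<rho> i \<noteq> j \<and>
    ((A = {\<sigma> \<in> coset1 n i j. perm_intersect n \<sigma> \<rho>} \<and> B = coset1 n i j \<union> {\<rho>}) \<or>
     (B = {\<sigma> \<in> coset1 n i j. perm_intersect n \<sigma> \<rho>} \<and> A = coset1 n i j \<union> {\<rho>}))"
proof -
  have L1: "L \<ge> 1" using one_le_power[OF M(1), of 6] unfolding L_def by linarith
  have "1 * (1 + K) \<le> L * (1 + K)" using L1 by (rule mult_le_mono1)
  then have KL: "K + 1 \<le> L * (1 + K)" by (simp only: mult_1 add.commute)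
  have LKn: "100 * (L * (1 + K)) + M + 100 \<le> n" using n by (simp add: mult.assoc)
  have n102: "n \<ge> 102" "M < n" using LKn KL by auto
  have M4: "n ^ 4 \<le> fact M" using M by simp
  have M2: "3 * n\<^sup>2 < fact M"
  proof -
    have "n\<^sup>2 * 1 \<le> n\<^sup>2 * n\<^sup>2" using n102 by (intro mult_le_mono2) auto
    then have "n\<^sup>2 \<le> n ^ 4" by (simp flip: power_add)
    moreover have "0 < n ^ 4" using n102 by simp
    ultimately show ?thesis using M(2) by linarith
  qed
  define F :: real where "F = fact (n - 1)"
  define G :: real where "G = fact (n - 2)"
  define D :: real where "D = real (derangements (n - 1)) + real (derangements (n - 2))"
  have FG: "F = (real n - 1) * G" unfolding F_def G_def
    using n102 by (subst fact_reduce) (auto simp: of_nat_diff numeral_2_eq_2 One_nat_def)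
  have G0: "G > 0" and F0: "F > 0" by (simp_all add: F_def G_def)
  have G101: "101 * G \<le> F" unfolding FG using n102 G0 by (intro mult_right_mono) auto
  have D1: "F \<le> 3 * D"
  proof -
    have "fact (n - 1) \<le> 3 * derangements (n - 1)" using n102 by (intro derangements_bounds) auto
    then have "real (fact (n - 1)) \<le> real (3 * derangements (n - 1))" by (rule of_nat_mono)
    then show ?thesis by (simp add: F_def D_def)
  qed
  have D2: "2 * D \<le> F + G"
  proof -
    have "2 * derangements (n - 1) \<le> fact (n - 1)" "2 * derangements (n - 2) \<le> fact (n - 2)"
      using n102 by (auto intro!: derangements_bounds)
    then have "real (2 * derangements (n - 1)) \<le> real (fact (n - 1))"
      "real (2 * derangements (n - 2)) \<le> real (fact (n - 2))" by (auto simp only: of_nat_le_iff)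
    then show ?thesis by (simp add: F_def G_def D_def)
  qed
  define W where "W = F - D"
  \<comment> \<open>\<open>D2\<close> and \<open>G101\<close> give F/2 - F/202, rounded down to
    49/100; the 2/3 is \<open>D1\<close>.\<close>
  have W: "49 / 100 * F \<le> W" "W \<le> 2 / 3 * F" using D1 D2 G101 F0 G0 by (auto simp: W_def)
  have W_nat: "real (fact (n - 1) - (derangements (n - 1) + derangements (n - 2))) = W"
  proof -
    have "D \<le> F" using D2 G101 F0 by linarith
    then have "real (derangements (n - 1) + derangements (n - 2)) \<le> real (fact (n - 1))"
      by (simp add: D_def F_def)
    then have "derangements (n - 1) + derangements (n - 2) \<le> fact (n - 1)" by (simp only: of_nat_le_iff)
    then show ?thesis by (simp add: of_nat_diff W_def F_def D_def)
  qed
  have big: "W * (F + 1) \<le> real (card A) * real (card B)"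
  proof -
    have "real ((fact (n - 1) - (derangements (n - 1) + derangements (n - 2))) * (fact (n - 1) + 1))
       \<le> real (card A * card B)" using large by (rule of_nat_mono)
    then show ?thesis unfolding of_nat_mult W_nat by (simp add: F_def)
  qed
  have "49 / 100 * F * F \<le> W * F" using W F0 by (intro mult_right_mono) auto
  also have "\<dots> \<le> W * (F + 1)" using W F0 by (intro mult_left_mono) auto
  finally have c49: "49 / 100 * (fact (n - 1))\<^sup>2 \<le> real (card A) * real (card B)"
    using big by (simp add: F_def power2_eq_square)
  have cross': "cross_intersecting n B A" using cross cross_intersecting_commute by blast
  obtain i j where ij: "i \<in> {1..n}" "j \<in> {1..n}"
    and heavyA: "fact (n - 1) / real L \<le> real (card (A \<inter> coset1 n i j))"
    using large_cross_intersecting_heavy_cell[OF n102(1) AB cross M(1) _ M(2) c49] n102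
    by (auto simp: L_def)
  obtain k l where kl: "k \<in> {1..n}" "l \<in> {1..n}"
    and heavyB: "fact (n - 1) / real L \<le> real (card (B \<inter> coset1 n k l))"
    using large_cross_intersecting_heavy_cell[OF n102(1) AB(2,1) cross' M(1) _ M(2)] n102 c49
    by (auto simp: L_def mult.commute)
  have n5: "n \<ge> 5" using n102 by simp
  have K_eq: "(real M + 2)\<^sup>2 * real L = real K" by (simp add: K_def)
  have outB: "real (card (B - coset1 n i j)) \<le> real K * G"
    using few_outside_heavy_coset[OF n5 AB cross M(1) n102(2) M4 ij _ heavyA] L1
    unfolding K_eq G_def by simp
  have outA: "real (card (A - coset1 n k l)) \<le> real K * G"
    using few_outside_heavy_coset[OF n5 AB(2,1) cross' M(1) n102(2) M4 kl _ heavyB] L1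
    unfolding K_eq G_def by simp
  have eq: "(i, j) = (k, l)"
  proof (rule ccontr)
    assume ne: "(i, j) \<noteq> (k, l)"
    have fin: "finite A" using AB finite_subset_Sym by auto
    have "A \<inter> coset1 n i j \<subseteq> (coset1 n i j \<inter> coset1 n k l) \<union> (A - coset1 n k l)" by auto
    then have "card (A \<inter> coset1 n i j) \<le> card ((coset1 n i j \<inter> coset1 n k l) \<union> (A - coset1 n k l))"
      using fin by (intro card_mono) auto
    also have "\<dots> \<le> card (coset1 n i j \<inter> coset1 n k l) + card (A - coset1 n k l)" by (rule card_Un_le)
    also have "\<dots> \<le> fact (n - 2) + card (A - coset1 n k l)"
      using card_coset1_Int_le[OF ij kl ne] by simp
    finally have "real (card (A \<inter> coset1 n i j)) \<le> real (fact (n - 2) + card (A - coset1 n k l))"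
      by (rule of_nat_mono)
    also have "\<dots> \<le> (1 + real K) * G" using outA by (simp add: G_def algebra_simps)
    finally have "F / real L \<le> (1 + real K) * G" using heavyA by (simp add: F_def)
    then have "(real n - 1) * G \<le> (real L * (1 + real K)) * G"
      unfolding FG using L1 by (simp add: divide_le_eq mult_ac)
    then have "real n - 1 \<le> real L * (1 + real K)" using G0 by simp
    moreover have "real (L * (1 + K)) + 1 < real n" using LKn by linarith
    ultimately show False by simp
  qed
  then have outA: "real (card (A - coset1 n i j)) \<le> real K * G" using outA by simp
  have KF: "100 * (real K * G) \<le> F"
  proof -
    have "real (100 * K) \<le> real n - 1" using LKn KL by linarith
    then have "real (100 * K) * G \<le> (real n - 1) * G" using G0 by (intro mult_right_mono) auto
    then show ?thesis unfolding FG by simp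
  qed
  \<comment> \<open>At most K (n-2)! outsiders under the requirement
    \<open>6 * card C \<le> t * fact (n - 2)\<close> dictate \<open>t = 6 * K\<close>.\<close>
  have t: "6 * (6 * K) \<le> n - 2" "6 * K + M + 1 \<le> n" using LKn KL by auto
  have small: "6 * card (C - coset1 n i j) \<le> (6 * K) * fact (n - 2)"
    if "real (card (C - coset1 n i j)) \<le> real K * G" for C
  proof -
    have "real (6 * card (C - coset1 n i j)) \<le> real ((6 * K) * fact (n - 2))"
      using that by (simp add: G_def)
    then show ?thesis by (simp only: of_nat_le_iff)
  qed
  \<comment> \<open>One element of \<open>Y\<close> outside the coset cuts the part of
    \<open>X\<close> inside it down to \<open>W\<close>; the rest of \<open>X\<close> is at most
    F/100 by \<open>KF\<close>.\<close>
  have one_side: "real (card X) \<le> W + F / 100"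
    if X: "X \<subseteq> Sym n" "Y \<subseteq> Sym n" "cross_intersecting n X Y" "\<not> Y \<subseteq> coset1 n i j"
      and out: "real (card (X - coset1 n i j)) \<le> real K * G" for X Y
  proof -
    obtain \<rho> where r: "\<rho> \<in> Y" "\<rho> \<in> Sym n" "\<rho> i \<noteq> j" using X by (auto simp: coset1_def)
    have "X \<inter> coset1 n i j \<subseteq> {\<sigma> \<in> coset1 n i j. perm_intersect n \<sigma> \<rho>}"
      using X(3) r(1) unfolding cross_intersecting_def by auto
    then have "card (X \<inter> coset1 n i j) \<le> card {\<sigma> \<in> coset1 n i j. perm_intersect n \<sigma> \<rho>}"
      by (intro card_mono) (auto intro: finite_subset[OF _ finite_coset1[of n i j]])
    also have "\<dots> = fact (n - 1) - (derangements (n - 1) + derangements (n - 2))"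
      using card_coset1_hitting[OF ij r(2,3)] by simp
    finally have "real (card (X \<inter> coset1 n i j)) \<le> W" unfolding W_nat[symmetric] by (rule of_nat_mono)
    moreover have "card X = card (X \<inter> coset1 n i j) + card (X - coset1 n i j)"
      using finite_subset_Sym[OF X(1)] card_Int_Diff by blast
    ultimately show ?thesis using out KF by simp
  qed
  consider "\<not> A \<subseteq> coset1 n i j" "\<not> B \<subseteq> coset1 n i j" | "A \<subseteq> coset1 n i j" "\<not> B \<subseteq> coset1 n i j"
    | "\<not> A \<subseteq> coset1 n i j" "B \<subseteq> coset1 n i j" using not_coset ij by blast
  then show ?thesis
  proof cases
    case 1
    have "real (card A) * real (card B) \<le> (W + F / 100) * (W + F / 100)"
      using one_side[OF AB cross 1(2) outA] one_side[OF AB(2,1) cross' 1(1) outB] W F0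
      by (intro mult_mono) auto
    also have "\<dots> < W * F"
    proof -
      have "W * W \<le> W * (2 / 3 * F)" using W F0 by (intro mult_left_mono) auto
      moreover have "F * F \<le> 100 / 49 * W * F" using W F0 by (intro mult_right_mono) auto
      moreover have "W * F > 0" using W F0 by (intro mult_pos_pos) auto
      moreover have "(W + F / 100) * (W + F / 100) = W * W + W * F / 50 + F * F / 10000"
        by (simp add: algebra_simps)
      ultimately show ?thesis by simp
    qed
    also have "\<dots> \<le> W * (F + 1)" using W F0 by (intro mult_left_mono) auto
    finally show ?thesis using big by simp
  next
    case 2
    from extremal_from_one_sided[OF n5 AB cross ij 2 small[OF outB] less_imp_le[OF n102(2)] M2 t large]
    show ?thesis using ij by blast
  next
    case 3
    from extremal_from_one_sided[OF n5 AB(2,1) cross' ij 3(2,1) small[OF outA] less_imp_le[OF n102(2)] M2 t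
        large[unfolded mult.commute[of "card A"]]]
    show ?thesis using ij by blast
  qed
qed

section \<open>Choice of M and conclusion\<close>

lemma two_power_le_fact: "(2::nat) ^ m \<le> 2 * fact m"
proof (induction m)
  case (Suc m)
  show ?case
  proof (cases "m = 0")
    case False
    then have "2 * 2 ^ m \<le> Suc m * (2 * fact m)" using Suc by (intro mult_le_mono) auto
    then show ?thesis by (simp add: algebra_simps)
  qed simp
qed simp

text \<open>M is the integer part of n^(1/20). The polynomial condition has degree 14 in M, less
  than 20, and M! is at least 2^(M-1), which outgrows every power of n.\<close>

lemma eventually_parameters:
  "eventually (\<lambda>n. \<exists>M. 1 \<le> M \<and> 100 * n ^ 4 \<le> fact M \<and>
     100 * (1056964608 * M ^ 6) * (1 + (M + 2)\<^sup>2 * (1056964608 * M ^ 6)) + M + 100 \<le> n) sequentially"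
proof -
  let ?x = "\<lambda>n::nat. real n powr (1 / 20)"
  have "eventually (\<lambda>n. 1 \<le> ?x n) sequentially" by real_asymp
  moreover have "eventually (\<lambda>n. 200 * real n ^ 4 \<le> 2 powr (?x n - 1)) sequentially" by real_asymp
  moreover have "eventually (\<lambda>n. 100 * (1056964608 * ?x n ^ 6) * (1 + (?x n + 2)\<^sup>2 * (1056964608 * ?x n ^ 6))
      + ?x n + 100 \<le> real n) sequentially" by real_asymp
  ultimately show ?thesis
  proof eventually_elim
    case (elim n)
    \<comment> \<open>Rounding down loses at most 1, hence the exponent reduced by 1 in the second
      asymptotic estimate.\<close>
    define M where "M = nat \<lfloor>?x n\<rfloor>"
    have Mx: "real M \<le> ?x n" "?x n - 1 \<le> real M" using elim(1) by (simp_all add: M_def)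
    have "1 \<le> M" using elim(1) by (simp add: M_def le_nat_iff)
    moreover have "100 * n ^ 4 \<le> fact M"
    proof -
      have "200 * real n ^ 4 \<le> 2 powr real M"
        using elim(2) powr_mono[OF Mx(2), of 2] by linarith
      also have "\<dots> = real (2 ^ M)" by (simp add: powr_realpow)
      also have "\<dots> \<le> real (2 * fact M)" using two_power_le_fact by (rule of_nat_mono)
      finally have "real (100 * n ^ 4) \<le> real (fact M)" by simp
      then show ?thesis by (simp only: of_nat_le_iff)
    qed
    moreover have "100 * (1056964608 * M ^ 6) * (1 + (M + 2)\<^sup>2 * (1056964608 * M ^ 6)) + M + 100 \<le> n"
    proof -
      have "real (100 * (1056964608 * M ^ 6) * (1 + (M + 2)\<^sup>2 * (1056964608 * M ^ 6)) + M + 100)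
        = 100 * (1056964608 * real M ^ 6) * (1 + (real M + 2)\<^sup>2 * (1056964608 * real M ^ 6)) + real M + 100"
        by simp
      also have "\<dots> \<le> 100 * (1056964608 * ?x n ^ 6) * (1 + (?x n + 2)\<^sup>2 * (1056964608 * ?x n ^ 6)) + ?x n + 100"
        using Mx(1) by (intro add_mono mult_mono power_mono order.refl) auto
      also have "\<dots> \<le> real n" by (rule elim(3))
      finally show ?thesis by (simp only: of_nat_le_iff)
    qed
    ultimately show ?case by blast
  qed
qed

lemma extremal_product:
  assumes "i \<in> {1..n}" "j \<in> {1..n}" "\<rho> \<in> Sym n" "\<rho> i \<noteq> j"
  shows "int (card {\<sigma> \<in> coset1 n i j. perm_intersect n \<sigma> \<rho>}) * int (card (coset1 n i j \<union> {\<rho>}))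
    = (int (fact (n - 1)) - int (derangements (n - 1)) - int (derangements (n - 2))) * (int (fact (n - 1)) + 1)"
proof -
  have "int (card {\<sigma> \<in> coset1 n i j. perm_intersect n \<sigma> \<rho>} + (derangements (n - 1) + derangements (n - 2)))
      = int (fact (n - 1))" by (simp only: card_coset1_hitting[OF assms])
  then have "int (card {\<sigma> \<in> coset1 n i j. perm_intersect n \<sigma> \<rho>})
      = int (fact (n - 1)) - int (derangements (n - 1)) - int (derangements (n - 2))" by simp
  moreover have "card (coset1 n i j \<union> {\<rho>}) = fact (n - 1) + 1"
    using assms by (subst card_Un_disjoint) (auto simp: coset1_def card_coset1[unfolded coset1_def])
  ultimately show ?thesis by simp
qed

text \<open>Hypotheses and bound are symmetric in \<open>A\<close> and \<open>B\<close>, so the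
  equality case lists both assignments of the two roles. Over the integers the subtraction of the
  derangement numbers is never truncated.\<close>

theorem theorem10:
  shows "\<exists>n0::nat. \<forall>n\<ge>n0. \<forall>A B.
    A \<subseteq> Sym n \<and> B \<subseteq> Sym n \<and> cross_intersecting n A B \<and>
    \<not> (\<exists>i\<in>{1..n}. \<exists>j\<in>{1..n}. A \<subseteq> coset1 n i j \<and> B \<subseteq> coset1 n i j)
    \<longrightarrow>
      int (card A) * int (card B)
        \<le> (int (fact (n - 1)) - int (derangements (n - 1)) - int (derangements (n - 2)))
           * (int (fact (n - 1)) + 1)
    \<and> (int (card A) * int (card B)
        = (int (fact (n - 1)) - int (derangements (n - 1)) - int (derangements (n - 2)))
           * (int (fact (n - 1)) + 1)
       \<longleftrightarrow>
       (\<exists>i\<in>{1..n}. \<exists>j\<in>{1..n}. \<exists>\<rho>\<in>Sym n. \<rho> i \<noteq> j \<and>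
          ((A = {\<sigma> \<in> coset1 n i j. perm_intersect n \<sigma> \<rho>} \<and> B = coset1 n i j \<union> {\<rho>}) \<or>
           (B = {\<sigma> \<in> coset1 n i j. perm_intersect n \<sigma> \<rho>} \<and> A = coset1 n i j \<union> {\<rho>}))))"
proof -
  obtain n0 where n0: "\<And>n. n \<ge> n0 \<Longrightarrow> \<exists>M. 1 \<le> M \<and> 100 * n ^ 4 \<le> fact M \<and>
     100 * (1056964608 * M ^ 6) * (1 + (M + 2)\<^sup>2 * (1056964608 * M ^ 6)) + M + 100 \<le> n"
    using eventually_parameters unfolding eventually_sequentially by blast
  show ?thesis
  proof (intro exI[of _ n0] allI impI)
    fix n :: nat and A B assume n: "n \<ge> n0"
      and hyp: "A \<subseteq> Sym n \<and> B \<subseteq> Sym n \<and> cross_intersecting n A B \<and>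
        \<not> (\<exists>i\<in>{1..n}. \<exists>j\<in>{1..n}. A \<subseteq> coset1 n i j \<and> B \<subseteq> coset1 n i j)"
    let ?ext = "\<exists>i\<in>{1..n}. \<exists>j\<in>{1..n}. \<exists>\<rho>\<in>Sym n. \<rho> i \<noteq> j \<and>
          ((A = {\<sigma> \<in> coset1 n i j. perm_intersect n \<sigma> \<rho>} \<and> B = coset1 n i j \<union> {\<rho>}) \<or>
           (B = {\<sigma> \<in> coset1 n i j. perm_intersect n \<sigma> \<rho>} \<and> A = coset1 n i j \<union> {\<rho>}))"
    define W where "W = int (fact (n - 1)) - int (derangements (n - 1)) - int (derangements (n - 2))"
    define F where "F = int (fact (n - 1))"
    obtain M where M: "1 \<le> M" "100 * n ^ 4 \<le> fact M"
     "100 * (1056964608 * M ^ 6) * (1 + (M + 2)\<^sup>2 * (1056964608 * M ^ 6)) + M + 100 \<le> n"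
      using n0[OF n] by blast
    \<comment> \<open>A product that reaches the bound forces the extremal form, and the extremal
      form attains the bound exactly. This yields the inequality together with the equality
      case.\<close>
    have 1: ?ext if "W * (F + 1) \<le> int (card A) * int (card B)"
    proof (rule large_cross_intersecting_extremal[OF M])
      \<comment> \<open>\<open>max 0 W\<close> mediates between the truncated subtraction of natural
        numbers and the integer \<open>W\<close>.\<close>
      have "int (fact (n - 1) - (derangements (n - 1) + derangements (n - 2))) \<le> max 0 W"
        unfolding W_def by linarith
      then have "int (fact (n - 1) - (derangements (n - 1) + derangements (n - 2))) * (F + 1) \<le> max 0 W * (F + 1)"
        by (rule mult_right_mono) (simp add: F_def)
      also have "max 0 W * (F + 1) \<le> int (card A) * int (card B)"
        using that by (cases "W \<ge> 0") auto
      finally have "int (fact (n - 1) - (derangements (n - 1) + derangements (n - 2))) * (F + 1)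
          \<le> int (card A) * int (card B)" .
      then have "int ((fact (n - 1) - (derangements (n - 1) + derangements (n - 2))) * (fact (n - 1) + 1))
          \<le> int (card A * card B)" by (simp add: F_def)
      then show "(fact (n - 1) - (derangements (n - 1) + derangements (n - 2))) * (fact (n - 1) + 1)
          \<le> card A * card B" by (simp only: of_nat_le_iff)
    qed (use hyp in auto)
    have 2: "int (card A) * int (card B) = W * (F + 1)" if ext: ?ext
    proof -
      from ext obtain i j \<rho> where r: "i \<in> {1..n}" "j \<in> {1..n}" "\<rho> \<in> Sym n" "\<rho> i \<noteq> j"
        and AB: "(A = {\<sigma> \<in> coset1 n i j. perm_intersect n \<sigma> \<rho>} \<and> B = coset1 n i j \<union> {\<rho>}) \<or>
           (B = {\<sigma> \<in> coset1 n i j. perm_intersect n \<sigma> \<rho>} \<and> A = coset1 n i j \<union> {\<rho>})" by blast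
      from AB show ?thesis
      proof (elim disjE conjE)
        assume "A = {\<sigma> \<in> coset1 n i j. perm_intersect n \<sigma> \<rho>}" "B = coset1 n i j \<union> {\<rho>}"
        then show ?thesis using extremal_product[OF r] by (simp only: W_def F_def)
      next
        assume "B = {\<sigma> \<in> coset1 n i j. perm_intersect n \<sigma> \<rho>}" "A = coset1 n i j \<union> {\<rho>}"
        then have "int (card B) * int (card A) = W * (F + 1)"
          using extremal_product[OF r] by (simp only: W_def F_def)
        then show ?thesis by (simp only: mult.commute)
      qed
    qed
    have "int (card A) * int (card B) \<le> W * (F + 1)"
    proof (cases "W * (F + 1) \<le> int (card A) * int (card B)")
      case True
      then show ?thesis using 2[OF 1] by simp
    qed simp
    moreover have "int (card A) * int (card B) = W * (F + 1) \<longleftrightarrow> ?ext"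
    proof
      assume "int (card A) * int (card B) = W * (F + 1)"
      then show ?ext by (intro 1) simp
    next
      assume ?ext
      then show "int (card A) * int (card B) = W * (F + 1)" by (rule 2)
    qed
    ultimately have "int (card A) * int (card B) \<le> W * (F + 1)
        \<and> (int (card A) * int (card B) = W * (F + 1) \<longleftrightarrow> ?ext)" by (rule conjI)
    then show "int (card A) * int (card B)
        \<le> (int (fact (n - 1)) - int (derangements (n - 1)) - int (derangements (n - 2)))
           * (int (fact (n - 1)) + 1)
    \<and> (int (card A) * int (card B)
        = (int (fact (n - 1)) - int (derangements (n - 1)) - int (derangements (n - 2)))
           * (int (fact (n - 1)) + 1) \<longleftrightarrow> ?ext)"
      unfolding W_def F_def .
  qed
qed

end
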